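(* Let $\lambda$, $\kappa$, $\Theta_0$ (open), $M_0$ and $\{P_{\boldsymbol\theta}\}_{\boldsymbol\theta\in\Theta_0}$ be as in the context, and let $\Theta\subset\Theta_0$ be a relatively closed subset of $\Theta_0$. For $\boldsymbol\theta\in\Theta$ define $$B_{\boldsymbol\theta}:=(\nabla\kappa(\boldsymbol\theta)+\nabla_\Theta(\boldsymbol\theta))\cap M_0,$$ where $\nabla_\Theta(\boldsymbol\theta)$ is the outward normal cone to $\Theta$ at $\boldsymbol\theta$. Assume that $\{B_{\boldsymbol\theta}:\boldsymbol\theta\in\Theta\}$ is a partition of $M_0$ and that the function $\varphi:M_0\to\Theta$ defined by $\varphi(\boldsymbol\mu)=\boldsymbol\theta\Longleftrightarrow\boldsymbol\mu\in B_{\boldsymbol\theta}$ is continuous. Moreover let $\boldsymbol\theta_0\in\Theta$ be such that, if $\boldsymbol x_1,\boldsymbol x_2,\ldots$ are i.i.d. with law $P_{\boldsymbol\theta_0}$, then for every $n$ the sample mean $\bar{\boldsymbol x}_n=\frac1n\sum_{i=1}^n\boldsymbol x_i$ takes values in $M_0$ almost surely. Then the following statements hold. (a) $\varphi_\Theta=\varphi$ is a continuous maximum likelihood estimator constrained to $\Theta$, and for every $\boldsymbol\theta\in\Theta$ the set $T_{\boldsymbol\theta}(\Theta)=\{\boldsymbol\theta'\in\Theta_0:\varphi_\Theta(\nabla\kappa(\boldsymbol\theta'))=\boldsymbol\theta\}$ equals $\nabla\kappa^*(B_{\boldsymbol\theta})$. (b) For $\boldsymbol\theta\in\Theta$, the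 inequality $$D(\boldsymbol\theta||\boldsymbol\theta_0)\le D(\boldsymbol\theta'||\boldsymbol\theta_0)\quad\text{for all }\boldsymbol\theta'\in T_{\boldsymbol\theta}(\Theta)$$ holds if and only if $\boldsymbol\theta_0\in(\boldsymbol\theta+A_{\boldsymbol\theta}(\Theta))\cap\Theta$, where $A_{\boldsymbol\theta}(\Theta)$ is the cone of admissible directions to $\Theta$ at $\boldsymbol\theta$. (c) The sequence of laws of $\{\varphi_\Theta(\bar{\boldsymbol x}_n)\}_{n\in\mathbb N}$ satisfies the large deviation principle on $\Theta$ with a rate function $I$ such that, for $\boldsymbol\theta\in\Theta$, $I(\boldsymbol\theta)=D(\boldsymbol\theta||\boldsymbol\theta_0)$ if and only if $\boldsymbol\theta_0\in(\boldsymbol\theta+A_{\boldsymbol\theta}(\Theta))\cap\Theta$; otherwise $I(\boldsymbol\theta)<D(\boldsymbol\theta||\boldsymbol\theta_0)$.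
   Context: Setting: $\lambda$ is a $\sigma$-finite Borel measure on $\mathbb R^d$, not concentrated on a proper affine submanifold of $\mathbb R^d$. Its cumulant generating function is $\kappa(\boldsymbol\theta)=\log\int_{\mathbb R^d}e^{\boldsymbol\theta\cdot\boldsymbol x}\lambda(d\boldsymbol x)\in(-\infty,+\infty]$, and its domain of finiteness $\Theta_0=\{\boldsymbol\theta:\kappa(\boldsymbol\theta)<\infty\}$ is assumed to be (nonempty and) open. The exponential family is $\frac{dP_{\boldsymbol\theta}}{d\lambda}(\boldsymbol x)=e^{\boldsymbol\theta\cdot\boldsymbol x-\kappa(\boldsymbol\theta)}$, $\boldsymbol\theta\in\Theta_0$. $M_0=\nabla\kappa(\Theta_0)$, which is the interior of the convex support of $\lambda$ (the smallest closed convex set whose complement is $\lambda$-null); $\nabla\kappa:\Theta_0\to M_0$ is a diffeomorphism with inverse $\nabla\kappa^*$, where $\kappa^*(\boldsymbol t)=\sup_{\boldsymbol\theta}\{\boldsymbol\theta\cdot\boldsymbol t-\kappa(\boldsymbol\theta)\}$. Cones: an admissible direction to $\Theta$ at $\boldsymbol\theta\in\Theta$ is a limit point of a sequence $\|\boldsymbol\theta_n-\boldsymbol\theta\|^{-1}(\boldsymbol\theta_n-\boldsymbol\theta)$, where $\{\boldsymbol\theta_n\}\subset\Theta$ (with $\boldsymbol\theta_n\ne\boldsymbol\theta$) is any sequence converging to $\boldsymbol\theta$. The cone of admissible directions $A_{\boldsymbol\theta}(\Theta)$ is the closed convex cone generated by all the admissible directions (equal to $\{\boldsymbol 0\}$ if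 there are none). The outward normal cone $\nabla_\Theta(\boldsymbol\theta)$ to $\Theta$ at $\boldsymbol\theta$ is the polar cone to $A_{\boldsymbol\theta}(\Theta)$: the set of $\boldsymbol v\in\mathbb R^d$ with $\boldsymbol w\cdot\boldsymbol v\le0$ for all $\boldsymbol w\in A_{\boldsymbol\theta}(\Theta)$. $D(\boldsymbol\theta_1||\boldsymbol\theta_2)=\int\log\frac{dP_{\boldsymbol\theta_1}}{dP_{\boldsymbol\theta_2}}\,dP_{\boldsymbol\theta_1}$ is the Kullback-Leibler divergence. An $m$-projection of $\boldsymbol\theta_1$ on $\Theta$ is any minimizer of $\boldsymbol\theta\mapsto D(\boldsymbol\theta_1||\boldsymbol\theta)$ over $\boldsymbol\theta\in\Theta$. A maximum likelihood estimator constrained to $\Theta$ is a Borel function $\varphi_\Theta$ on $M_0$ such that, for every $\boldsymbol t\in M_0$, $\varphi_\Theta(\boldsymbol t)$ is an $m$-projection of $\nabla\kappa^*(\boldsymbol t)$ on $\Theta$ (equivalently, a maximizer over $\boldsymbol\theta\in\Theta$ of $\boldsymbol\theta\cdot\boldsymbol t-\kappa(\boldsymbol\theta)$). A sequence $\{\phi_n\}$ of probability measures on a topological space $\mathcal X$ satisfies the large deviation principle (LDP) with rate function $I:\mathcal X\to[0,+\infty]$ if $I$ is lower semi-continuous with compact sub-level sets $\{I\le\eta\}$, $\eta\ge0$ (all rate functions are good), and for every Borel $A\subset\mathcal X$, $-\inf_{\mathrm{int}(A)}I\le\liminf_n n^{-1}\ln\phi_n(A)\le\limsup_n n^{-1}\ln\phi_n(A)\le-\inf_{\bar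 A}I$. *)

theory Defs
  imports "HOL-Probability.Probability"
begin

definition ln_ennreal :: "ennreal \<Rightarrow> ereal" where
  "ln_ennreal x = (if x = 0 then - \<infinity> else if x = \<infinity> then \<infinity> else ereal (ln (enn2real x)))"

definition gradient :: "('a::real_inner \<Rightarrow> real) \<Rightarrow> 'a \<Rightarrow> 'a" where
  "gradient f x = (THE D. GDERIV f x :> D)"

subsection \<open>Exponential families\<close>

definition cgf :: "'a::euclidean_space measure \<Rightarrow> 'a \<Rightarrow> ereal" where
  "cgf lam \<theta> = ln_ennreal (\<integral>\<^sup>+ x. ennreal (exp (\<theta> \<bullet> x)) \<partial>lam)"

definition cgf_domain :: "'a::euclidean_space measure \<Rightarrow> 'a set" where
  "cgf_domain lam = {\<theta>. cgf lam \<theta> < \<infinity>}"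

text \<open>Only used on the open set where the function is finite, so the real-valued truncation
  by \<^const>\<open>real_of_ereal\<close> does not affect the derivative; likewise for \<open>grad_conj\<close> below.\<close>

definition grad_cgf :: "'a::euclidean_space measure \<Rightarrow> 'a \<Rightarrow> 'a" where
  "grad_cgf lam = gradient (\<lambda>\<theta>. real_of_ereal (cgf lam \<theta>))"

definition mean_domain :: "'a::euclidean_space measure \<Rightarrow> 'a set" where
  "mean_domain lam = grad_cgf lam ` cgf_domain lam"

definition cgf_conj :: "'a::euclidean_space measure \<Rightarrow> 'a \<Rightarrow> ereal" where
  "cgf_conj lam t = (SUP \<theta>. ereal (\<theta> \<bullet> t) - cgf lam \<theta>)"

definition grad_conj :: "'a::euclidean_space measure \<Rightarrow> 'a \<Rightarrow> 'a" where
  "grad_conj lam = gradient (\<lambda>t. real_of_ereal (cgf_conj lam t))"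

definition exp_fam :: "'a::euclidean_space measure \<Rightarrow> 'a \<Rightarrow> 'a measure" where
  "exp_fam lam \<theta> = density lam (\<lambda>x. ennreal (exp (\<theta> \<bullet> x - real_of_ereal (cgf lam \<theta>))))"

text \<open>\<open>KL_div lam \<theta>\<^sub>1 \<theta>\<^sub>2\<close> is \<open>D(\<theta>\<^sub>1 || \<theta>\<^sub>2)\<close>; the library function
  \<^const>\<open>KL_divergence\<close> takes the base of the logarithm first and then
  the reference measure before the measure one integrates against.\<close>

definition KL_div :: "'a::euclidean_space measure \<Rightarrow> 'a \<Rightarrow> 'a \<Rightarrow> real" where
  "KL_div lam \<theta>\<^sub>1 \<theta>\<^sub>2 = KL_divergence (exp 1) (exp_fam lam \<theta>\<^sub>2) (exp_fam lam \<theta>\<^sub>1)"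

subsection \<open>Cones\<close>

text \<open>A limit point of a sequence is the limit of one of its subsequences.\<close>

definition admissible_directions :: "'a::euclidean_space set \<Rightarrow> 'a \<Rightarrow> 'a set" where
  "admissible_directions \<Theta> \<theta> =
    {u. \<exists>s::nat \<Rightarrow> 'a. (\<forall>n. s n \<in> \<Theta> \<and> s n \<noteq> \<theta>) \<and> s \<longlonglongrightarrow> \<theta> \<and>
        (\<exists>r. strict_mono r \<and> (\<lambda>n. (s (r n) - \<theta>) /\<^sub>R norm (s (r n) - \<theta>)) \<longlonglongrightarrow> u)}"

text \<open>Members of \<^const>\<open>convex_cone\<close> contain \<open>0\<close>, so the hull of the empty set is \<open>{0}\<close>.\<close>

definition admissible_cone :: "'a::euclidean_space set \<Rightarrow> 'a \<Rightarrow> 'a set" where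
  "admissible_cone \<Theta> \<theta> = (\<lambda>C. closed C \<and> convex_cone C) hull (admissible_directions \<Theta> \<theta>)"

definition normal_cone :: "'a::euclidean_space set \<Rightarrow> 'a \<Rightarrow> 'a set" where
  "normal_cone \<Theta> \<theta> = {v. \<forall>w \<in> admissible_cone \<Theta> \<theta>. w \<bullet> v \<le> 0}"

definition B_set :: "'a::euclidean_space measure \<Rightarrow> 'a set \<Rightarrow> 'a \<Rightarrow> 'a set" where
  "B_set lam \<Theta> \<theta> = ((\<lambda>v. grad_cgf lam \<theta> + v) ` normal_cone \<Theta> \<theta>) \<inter> mean_domain lam"

subsection \<open>Constrained maximum likelihood\<close>

definition m_projection :: "'a::euclidean_space measure \<Rightarrow> 'a set \<Rightarrow> 'a \<Rightarrow> 'a \<Rightarrow> bool" where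
  "m_projection lam \<Theta> \<theta>\<^sub>1 \<theta> \<longleftrightarrow> is_arg_min (KL_div lam \<theta>\<^sub>1) (\<lambda>\<theta>'. \<theta>' \<in> \<Theta>) \<theta>"

text \<open>Functions on \<open>mean_domain lam\<close> are total functions whose values elsewhere are irrelevant.\<close>

definition constrained_mle ::
    "'a::euclidean_space measure \<Rightarrow> 'a set \<Rightarrow> ('a \<Rightarrow> 'a) \<Rightarrow> bool" where
  "constrained_mle lam \<Theta> \<phi> \<longleftrightarrow>
    \<phi> \<in> borel_measurable (restrict_space borel (mean_domain lam)) \<and>
    (\<forall>t \<in> mean_domain lam. m_projection lam \<Theta> (grad_conj lam t) (\<phi> t))"

definition T_set :: "'a::euclidean_space measure \<Rightarrow> ('a \<Rightarrow> 'a) \<Rightarrow> 'a \<Rightarrow> 'a set" where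
  "T_set lam \<phi> \<theta> = {\<theta>' \<in> cgf_domain lam. \<phi> (grad_cgf lam \<theta>') = \<theta>}"

subsection \<open>Large deviations\<close>

definition borel_of :: "'b topology \<Rightarrow> 'b measure" where
  "borel_of X = sigma (topspace X) {U. openin X U}"

text \<open>Sequences of measures are indexed by \<open>n \<ge> 1\<close>; the entry at \<open>0\<close> is ignored.\<close>

definition good_rate_function :: "'b topology \<Rightarrow> ('b \<Rightarrow> ereal) \<Rightarrow> bool" where
  "good_rate_function X I \<longleftrightarrow>
    (\<forall>x \<in> topspace X. 0 \<le> I x) \<and>
    (\<forall>a::real. closedin X {x \<in> topspace X. I x \<le> ereal a}) \<and>
    (\<forall>\<eta>::real. 0 \<le> \<eta> \<longrightarrow> compactin X {x \<in> topspace X. I x \<le> ereal \<eta>})"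

definition satisfies_LDP :: "'b topology \<Rightarrow> (nat \<Rightarrow> 'b measure) \<Rightarrow> ('b \<Rightarrow> ereal) \<Rightarrow> bool" where
  "satisfies_LDP X \<nu> I \<longleftrightarrow>
    (\<forall>n\<ge>1. prob_space (\<nu> n) \<and> sets (\<nu> n) = sets (borel_of X)) \<and>
    good_rate_function X I \<and>
    (\<forall>A \<in> sets (borel_of X).
      (let a = (\<lambda>n. ereal (1 / real n) * ln_ennreal (emeasure (\<nu> n) A)) in
        - (INF x \<in> X interior_of A. I x) \<le> liminf a \<and>
        liminf a \<le> limsup a \<and>
        limsup a \<le> - (INF x \<in> X closure_of A. I x)))"

definition sample_mean :: "(nat \<Rightarrow> 'b \<Rightarrow> 'a::euclidean_space) \<Rightarrow> nat \<Rightarrow> 'b \<Rightarrow> 'a" where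
  "sample_mean X n \<omega> = (\<Sum>i<n. X i \<omega>) /\<^sub>R real n"

text \<open>The law on \<open>\<Theta>\<close> of \<open>\<phi>\<close> applied to the sample mean. Since \<open>\<phi>\<close> is only defined on
  \<open>mean_domain lam\<close>, the sample space is first restricted to the event that the sample mean
  lies there; this event is assumed to have probability one whenever the law is used.\<close>

definition estimator_law :: "'a::euclidean_space measure \<Rightarrow> 'a set \<Rightarrow> ('a \<Rightarrow> 'a) \<Rightarrow>
    'b measure \<Rightarrow> (nat \<Rightarrow> 'b \<Rightarrow> 'a) \<Rightarrow> nat \<Rightarrow> 'a measure" where
  "estimator_law lam \<Theta> \<phi> \<Omega> X n =
    distr (restrict_space \<Omega> {\<omega> \<in> space \<Omega>. sample_mean X n \<omega> \<in> mean_domain lam})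
      (borel_of (top_of_set \<Theta>)) (\<lambda>\<omega>. \<phi> (sample_mean X n \<omega>))"

end

theory Submission
  imports Defs
begin

text \<open>  Write \<open>\<kappa>\<close> for the cumulant generating function and consider the affine functions
  \<open>llr \<theta> \<theta>' s = (\<theta>' - \<theta>) \<bullet> s - (\<kappa> \<theta>' - \<kappa> \<theta>)\<close>, the logarithm of the density of
  \<open>P\<^bsub>\<theta>'\<^esub>\<close> relative to \<open>P\<^bsub>\<theta>\<^esub>\<close> at \<open>s\<close>. They add up along chains of parameters, and their value at the
  mean of \<open>P\<^bsub>\<theta>'\<^esub>\<close> is \<open>D(\<theta>'||\<theta>)\<close>. Since \<open>\<lambda>\<close> is not carried by a hyperplane, \<open>llr \<theta> \<theta>'\<close> is strictly
  negative at the mean of \<open>P\<^bsub>\<theta>\<^esub>\<close> when \<open>\<theta>' \<noteq> \<theta>\<close> (\<open>llr_mean_neg\<close>). Hence the mean map \<open>\<nabla>\<kappa>\<close> is injective,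
  invariance of domain makes \<open>M\<^sub>0\<close> open and the inverse continuous, the inverse is \<open>\<nabla>\<kappa>\<^sup>*\<close>, and
  \<open>J t = D(\<nabla>\<kappa>\<^sup>* t || \<theta>\<^sub>0)\<close> is the supremum of \<open>llr \<theta>\<^sub>0 \<theta>' t\<close> over \<open>\<theta>'\<close> for \<open>t \<in> M\<^sub>0\<close>.

  The other analytic ingredient is Fatou's lemma. If the sublevel set \<open>{\<theta>. \<kappa> \<theta> - \<theta> \<bullet> t \<le> a}\<close> is
  unbounded, a limit direction \<open>v\<close> of its elements satisfies \<open>v \<bullet> x \<le> v \<bullet> t\<close> for \<open>\<lambda>\<close>-almost all \<open>x\<close>
  (\<open>unbounded_dual_sublevel_imp_halfspace\<close>). This cannot happen for \<open>t \<in> M\<^sub>0\<close>, so there the sublevel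
  sets are compact and likelihoods attain their maxima. For \<open>t \<notin> M\<^sub>0\<close> it does happen, and
  if moreover \<open>\<lambda>\<close> is carried by \<open>M\<^sub>0\<close>, then \<open>llr \<theta>\<^sub>0 \<theta>' t\<close> is unbounded in \<open>\<theta>'\<close>: the rate \<open>J\<close> is infinite
  off \<open>M\<^sub>0\<close> (\<open>llr_unbounded_off_mean_domain\<close>).

  Part (a): a maximiser \<open>\<theta>\<close> of the likelihood over \<open>\<Theta>\<close> exists, and at any such \<open>\<theta>\<close> the gradient
  \<open>t - \<nabla>\<kappa> \<theta>\<close> lies in the normal cone. So \<open>t \<in> B\<^bsub>\<theta>\<^esub>\<close>, that is \<open>\<phi> t = \<theta>\<close>. Part (b): \<open>J\<close> is convex
  with gradient \<open>\<theta> - \<theta>\<^sub>0\<close> at \<open>\<nabla>\<kappa> \<theta>\<close>, so \<open>\<nabla>\<kappa> \<theta>\<close> minimises \<open>J\<close> over \<open>B\<^bsub>\<theta>\<^esub>\<close> exactly if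
  \<open>(\<theta>\<^sub>0 - \<theta>) \<bullet> v \<le> 0\<close> for every normal vector \<open>v\<close>, which by separation of a point from a closed
  convex cone says \<open>\<theta>\<^sub>0 - \<theta> \<in> A\<^bsub>\<theta>\<^esub>(\<Theta>)\<close>.

  Part (c) is Cramer's theorem on \<open>M\<^sub>0\<close> followed by contraction along \<open>\<phi>\<close>. A closed set
  on which \<open>J > a\<close> is covered by finitely many half-spaces \<open>{s. b < llr \<theta>\<^sub>0 \<theta>' s}\<close> with \<open>b > a\<close>
  (\<open>finite_halfspace_cover\<close>), each of probability at most \<open>exp (- n b)\<close> by Markov's inequality; this
  is the upper bound. The same estimate for the law tilted towards \<open>\<theta>\<close>, with \<open>a = 0\<close>, is
  a weak law of large numbers for the tilted law, and changing back to \<open>P\<^bsub>\<theta>\<^sub>0\<^esub>\<close> near \<open>t = \<nabla>\<kappa> \<theta>\<close> costs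
  \<open>exp (- n J t)\<close>; this is the lower bound. The contracted rate \<open>I \<theta>\<close> is the minimum of \<open>J\<close> over
  \<open>B\<^bsub>\<theta>\<^esub>\<close>, which (b) compares with \<open>J (\<nabla>\<kappa> \<theta>) = D(\<theta>||\<theta>\<^sub>0)\<close>.\<close>

section \<open>Exponential estimates and gradients\<close>

lemma abs_exp_minus_one_le: "\<bar>exp y - 1\<bar> \<le> \<bar>y\<bar> * exp \<bar>y\<bar>" for y :: real
proof (cases "y \<ge> 0")
  case True
  have "1 - y \<le> exp (- y)" using exp_ge_add_one_self[of "-y"] by simp
  then have "(1 - y) * exp y \<le> exp (-y) * exp y" by (intro mult_right_mono) auto
  then show ?thesis using True by (simp add: exp_minus algebra_simps)
next
  case False
  have "1 - exp y \<le> - y" using exp_ge_add_one_self[of y] by linarith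
  also have "- y \<le> \<bar>y\<bar> * exp \<bar>y\<bar>"
    using False mult_left_mono[of 1 "exp \<bar>y\<bar>" "\<bar>y\<bar>"] by simp
  finally show ?thesis using False by simp
qed

lemma abs_exp_minus_linear_le: "\<bar>exp y - 1 - y\<bar> \<le> y\<^sup>2 * exp \<bar>y\<bar>" for y :: real
proof -
  have a: "0 \<le> exp y - 1 - y" using exp_ge_add_one_self[of y] by linarith
  have "1 - y \<le> exp (- y)" using exp_ge_add_one_self[of "-y"] by simp
  then have "(1 - y) * exp y \<le> exp (-y) * exp y" by (intro mult_right_mono) auto
  then have "exp y - 1 - y \<le> y * (exp y - 1)" by (simp add: exp_minus algebra_simps)
  also have "\<dots> \<le> \<bar>y\<bar> * \<bar>exp y - 1\<bar>" by (metis abs_ge_self abs_mult)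
  also have "\<dots> \<le> \<bar>y\<bar> * (\<bar>y\<bar> * exp \<bar>y\<bar>)" by (intro mult_left_mono abs_exp_minus_one_le) auto
  finally show ?thesis using a by (simp add: power2_eq_square mult.assoc[symmetric])
qed

text \<open>  Half of the available exponential rate absorbs \<open>exp (h * y)\<close>, the other half absorbs \<open>y\<^sup>2\<close>; this
  supplies the integrable majorants for differentiation under the integral.\<close>

lemma square_exp_le:
  fixes h y \<delta> :: real
  assumes "0 < \<delta>" "0 \<le> y" "h \<le> \<delta> / 2"
  shows "y\<^sup>2 * exp (h * y) \<le> 8 / \<delta>\<^sup>2 * exp (\<delta> * y)"
proof -
  have "1 + \<delta>/2*y + (\<delta>/2*y)\<^sup>2 / 2 \<le> exp (\<delta>/2*y)"
    using assms by (intro exp_lower_Taylor_quadratic) auto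
  then have "(\<delta>/2*y)\<^sup>2 / 2 \<le> exp (\<delta>/2*y)"
    using assms mult_nonneg_nonneg[of "\<delta>/2" y] by linarith
  then have "y\<^sup>2 \<le> 8 / \<delta>\<^sup>2 * exp (\<delta>/2*y)"
    using assms by (simp add: field_simps power2_eq_square)
  moreover have "exp (h * y) \<le> exp (\<delta>/2*y)"
    using assms by (simp only: exp_le_cancel_iff) (rule mult_right_mono, auto)
  ultimately have "y\<^sup>2 * exp (h * y) \<le> (8 / \<delta>\<^sup>2 * exp (\<delta>/2*y)) * exp (\<delta>/2*y)"
    by (intro mult_mono) auto
  also have "\<dots> = 8 / \<delta>\<^sup>2 * exp (\<delta> * y)"
    by (simp add: mult.assoc exp_add[symmetric])
  finally show ?thesis .
qed

text \<open>  Some coordinate carries at least the average share of the norm, so that exponential moments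
  along the finitely many directions \<open>\<plusminus>b\<close>, with \<open>b\<close> in the basis, control those of the norm.\<close>

lemma exists_basis_norm_le:
  fixes x :: "'a::euclidean_space"
  shows "\<exists>b\<in>Basis. norm x \<le> real DIM('a) * \<bar>x \<bullet> b\<bar>"
proof (rule ccontr)
  assume "\<not> ?thesis"
  then have less: "\<bar>x \<bullet> b\<bar> < norm x / real DIM('a)" if "b \<in> Basis" for b
    using that DIM_positive[where 'a='a] by (auto simp: field_simps not_le)
  have "norm x \<le> (\<Sum>b\<in>Basis. \<bar>x \<bullet> b\<bar>)" by (rule norm_le_l1)
  also have "\<dots> < (\<Sum>b\<in>(Basis::'a set). norm x / real DIM('a))"
    by (rule sum_strict_mono) (use less in auto)
  finally show False using DIM_positive[where 'a='a] by simp
qed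

lemma gradient_eqI:
  assumes "GDERIV f x :> D"
  shows "gradient f x = D"
  unfolding gradient_def
proof (rule the_equality)
  fix E assume "GDERIV f x :> E"
  with assms have "(\<lambda>h. h \<bullet> D) = (\<lambda>h. h \<bullet> E)"
    unfolding gderiv_def by (rule has_derivative_unique)
  then have "(E - D) \<bullet> (E - D) = 0"
    unfolding inner_diff_right by (metis cancel_comm_monoid_add_class.diff_cancel)
  then show "E = D" by simp
qed (fact assms)

lemma GDERIV_remainder_tendsto:
  assumes "GDERIV f x :> D"
  shows "((\<lambda>y. (f y - f x - (y - x) \<bullet> D) / norm (y - x)) \<longlongrightarrow> 0) (at x)"
  using assms unfolding gderiv_def has_derivative_within by (simp add: divide_inverse mult.commute diff_diff_eq)

lemma GDERIV_of_quadratic_remainder: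
  fixes f :: "'a::real_inner \<Rightarrow> real"
  assumes "0 < \<delta>" and bound: "\<And>h. norm h \<le> \<delta> \<Longrightarrow> \<bar>f (x + h) - f x - h \<bullet> D\<bar> \<le> C * (norm h)\<^sup>2"
  shows "GDERIV f x :> D"
  unfolding gderiv_def has_derivative_at
proof (intro conjI)
  show "bounded_linear (\<lambda>h. h \<bullet> D)" by (rule bounded_linear_inner_left)
  show "(\<lambda>h. norm (f (x + h) - f x - h \<bullet> D) / norm h) \<midarrow>0\<rightarrow> 0"
  proof (rule Lim_null_comparison)
    show "\<forall>\<^sub>F h in at 0. norm (norm (f (x + h) - f x - h \<bullet> D) / norm h) \<le> C * norm h"
      unfolding eventually_at
    proof (intro exI[of _ \<delta>] conjI ballI impI)
      fix h :: 'a assume "h \<noteq> 0 \<and> dist h 0 < \<delta>"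
      then show "norm (norm (f (x + h) - f x - h \<bullet> D) / norm h) \<le> C * norm h"
        using bound[of h] by (simp add: divide_simps power2_eq_square mult.assoc)
    qed fact
    show "(\<lambda>h. C * norm h) \<midarrow>0\<rightarrow> 0"
      by (rule tendsto_eq_intros refl | simp)+
  qed
qed

section \<open>Differentiability of the cumulant generating function\<close>

locale full_exponential_family =
  fixes lam :: "'a::euclidean_space measure"
  assumes sets_lam [measurable_cong]: "sets lam = sets borel"
    and sigma_finite_lam: "sigma_finite_measure lam"
    and not_affine: "\<And>S. affine S \<Longrightarrow> S \<noteq> UNIV \<Longrightarrow> \<not> (AE x in lam. x \<in> S)"
    and open_domain: "open (cgf_domain lam)"
begin

abbreviation "\<Theta>0 \<equiv> cgf_domain lam"
abbreviation "\<kappa> \<equiv> \<lambda>\<theta>. real_of_ereal (cgf lam \<theta>)"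
abbreviation "mean \<equiv> grad_cgf lam"
abbreviation "M0 \<equiv> mean_domain lam"

lemma space_lam [simp]: "space lam = UNIV"
  using sets_eq_imp_space_eq[OF sets_lam] by simp

lemma not_AE_hyperplane:
  assumes "v \<noteq> 0"
  shows "\<not> (AE x in lam. v \<bullet> x = c)"
proof -
  have "v \<bullet> (((c + 1) / (v \<bullet> v)) *\<^sub>R v) \<noteq> c" using assms by simp
  then have "{x. v \<bullet> x = c} \<noteq> UNIV" by blast
  then show ?thesis using not_affine[OF affine_hyperplane[of v c]] by simp
qed

lemma nn_integral_exp_pos: "(\<integral>\<^sup>+ x. ennreal (exp (\<theta> \<bullet> x)) \<partial>lam) \<noteq> 0"
proof
  assume "(\<integral>\<^sup>+ x. ennreal (exp (\<theta> \<bullet> x)) \<partial>lam) = 0"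
  then have "AE x in lam. ennreal (exp (\<theta> \<bullet> x)) = 0"
    by (subst (asm) nn_integral_0_iff_AE) auto
  then have "AE x in lam. x \<in> {}" by eventually_elim simp
  then show False using not_affine[of "{}"] by simp
qed

lemma mem_domain_iff: "\<theta> \<in> \<Theta>0 \<longleftrightarrow> integrable lam (\<lambda>x. exp (\<theta> \<bullet> x))"
proof -
  have "\<theta> \<in> \<Theta>0 \<longleftrightarrow> (\<integral>\<^sup>+ x. ennreal (exp (\<theta> \<bullet> x)) \<partial>lam) < \<infinity>"
    by (auto simp: cgf_domain_def cgf_def ln_ennreal_def nn_integral_exp_pos less_top)
  also have "\<dots> \<longleftrightarrow> integrable lam (\<lambda>x. exp (\<theta> \<bullet> x))"
    by (simp add: integrable_iff_bounded)
  finally show ?thesis .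
qed

definition "partition_fun \<theta> = (LINT x|lam. exp (\<theta> \<bullet> x))"
definition "first_moment \<theta> = (LINT x|lam. exp (\<theta> \<bullet> x) *\<^sub>R x)"

lemma nn_integral_exp_inner:
  assumes "\<theta> \<in> \<Theta>0"
  shows "(\<integral>\<^sup>+ x. ennreal (exp (\<theta> \<bullet> x)) \<partial>lam) = ennreal (partition_fun \<theta>)"
  unfolding partition_fun_def using assms by (intro nn_integral_eq_integral) (auto simp: mem_domain_iff)

lemma partition_fun_pos: "\<theta> \<in> \<Theta>0 \<Longrightarrow> 0 < partition_fun \<theta>"
  using nn_integral_exp_pos[of \<theta>] nn_integral_exp_inner[of \<theta>]
  by (metis ennreal_0 ennreal_neg linorder_not_le)

lemma cgf_eq_ln: "\<theta> \<in> \<Theta>0 \<Longrightarrow> cgf lam \<theta> = ereal (ln (partition_fun \<theta>))"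
  using partition_fun_pos[of \<theta>]
  by (simp add: cgf_def nn_integral_exp_inner ln_ennreal_def)

lemma cgf_outside_domain: "\<theta> \<notin> \<Theta>0 \<Longrightarrow> cgf lam \<theta> = \<infinity>"
  by (simp add: cgf_domain_def)

lemma exp_kappa: "\<theta> \<in> \<Theta>0 \<Longrightarrow> exp (\<kappa> \<theta>) = partition_fun \<theta>"
  by (simp add: cgf_eq_ln partition_fun_pos)

text \<open>  Because the domain is open, \<open>\<theta> \<plusminus> r b\<close> belongs to it for every basis vector \<open>b\<close> and some \<open>r > 0\<close>,
  and the sum of these exponentials dominates \<open>exp (\<theta> \<bullet> x + \<delta> * norm x)\<close>.\<close>

lemma exp_tilt_norm_integrable:
  assumes "\<theta> \<in> \<Theta>0"
  obtains \<delta> where "0 < \<delta>" "integrable lam (\<lambda>x. exp (\<theta> \<bullet> x + \<delta> * norm x))"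
proof -
  obtain r where r: "0 < r" "cball \<theta> r \<subseteq> \<Theta>0"
    using open_domain assms open_contains_cball by blast
  \<comment> \<open>Some coordinate of \<open>x\<close> is at least \<open>norm x / DIM\<close>, so this rate keeps \<open>\<delta> * norm x\<close> below \<open>r * \<bar>x \<bullet> b\<bar>\<close>.\<close>
  define \<delta> where "\<delta> = r / real DIM('a)"
  have "0 < \<delta>" using r by (simp add: \<delta>_def)
  moreover have "integrable lam (\<lambda>x. exp (\<theta> \<bullet> x + \<delta> * norm x))"
  proof (rule Bochner_Integration.integrable_bound)
    have "\<theta> + r *\<^sub>R b \<in> \<Theta>0" "\<theta> - r *\<^sub>R b \<in> \<Theta>0" if "b \<in> Basis" for b
      using r that by (auto simp: subset_eq dist_norm)
    then show "integrable lam (\<lambda>x. \<Sum>b\<in>Basis. exp ((\<theta> + r *\<^sub>R b) \<bullet> x) + exp ((\<theta> - r *\<^sub>R b) \<bullet> x))"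
      by (intro Bochner_Integration.integrable_sum Bochner_Integration.integrable_add)
        (auto simp: mem_domain_iff)
    show "AE x in lam. norm (exp (\<theta> \<bullet> x + \<delta> * norm x)) \<le>
        norm (\<Sum>b\<in>Basis. exp ((\<theta> + r *\<^sub>R b) \<bullet> x) + exp ((\<theta> - r *\<^sub>R b) \<bullet> x))"
    proof (intro AE_I2)
      fix x :: 'a
      let ?f = "\<lambda>b. exp ((\<theta> + r *\<^sub>R b) \<bullet> x) + exp ((\<theta> - r *\<^sub>R b) \<bullet> x)"
      obtain b where b: "b \<in> Basis" "norm x \<le> real DIM('a) * \<bar>x \<bullet> b\<bar>"
        using exists_basis_norm_le by blast
      have "\<delta> * norm x \<le> \<delta> * (real DIM('a) * \<bar>x \<bullet> b\<bar>)"
        using b \<open>0 < \<delta>\<close> by (intro mult_left_mono) auto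
      then have "\<delta> * norm x \<le> r * \<bar>x \<bullet> b\<bar>" by (simp add: \<delta>_def)
      then have "exp (\<theta> \<bullet> x + \<delta> * norm x) \<le> exp (\<theta> \<bullet> x + r * \<bar>x \<bullet> b\<bar>)" by simp
      also have "\<dots> \<le> ?f b"
        by (cases "x \<bullet> b \<ge> 0")
          (auto simp: inner_add_left inner_diff_left inner_commute[of b x]
            intro: add_increasing add_increasing2)
      also have "\<dots> \<le> (\<Sum>b\<in>Basis. ?f b)"
        by (rule member_le_sum) (use b in \<open>auto intro: add_nonneg_nonneg\<close>)
      finally show "norm (exp (\<theta> \<bullet> x + \<delta> * norm x)) \<le> norm (\<Sum>b\<in>Basis. ?f b)"
        by simp
    qed
  qed measurable
  ultimately show ?thesis by (rule that)
qed

lemma first_moment_integrable: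
  assumes "\<theta> \<in> \<Theta>0"
  shows "integrable lam (\<lambda>x. exp (\<theta> \<bullet> x) *\<^sub>R x)"
proof -
  obtain \<delta> where \<delta>: "0 < \<delta>" "integrable lam (\<lambda>x. exp (\<theta> \<bullet> x + \<delta> * norm x))"
    using exp_tilt_norm_integrable[OF assms] .
  show ?thesis
  proof (rule Bochner_Integration.integrable_bound)
    show "integrable lam (\<lambda>x. (1/\<delta>) * exp (\<theta> \<bullet> x + \<delta> * norm x))" using \<delta> by simp
    show "AE x in lam. norm (exp (\<theta> \<bullet> x) *\<^sub>R x) \<le> norm ((1/\<delta>) * exp (\<theta> \<bullet> x + \<delta> * norm x))"
    proof (intro AE_I2)
      fix x :: 'a
      have "\<delta> * norm x \<le> exp (\<delta> * norm x)" using exp_ge_add_one_self[of "\<delta> * norm x"] by linarith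
      then show "norm (exp (\<theta> \<bullet> x) *\<^sub>R x) \<le> norm ((1/\<delta>) * exp (\<theta> \<bullet> x + \<delta> * norm x))"
        using \<delta> by (simp add: exp_add field_simps mult_left_mono)
    qed
  qed measurable
qed

lemma integral_exp_affine:
  assumes "\<theta> \<in> \<Theta>0"
  shows "integrable lam (\<lambda>x. exp (\<theta> \<bullet> x) * (v \<bullet> x - c))"
    and "(LINT x|lam. exp (\<theta> \<bullet> x) * (v \<bullet> x - c)) = v \<bullet> first_moment \<theta> - c * partition_fun \<theta>"
proof -
  have eq: "(\<lambda>x. exp (\<theta> \<bullet> x) * (v \<bullet> x - c)) = (\<lambda>x. v \<bullet> (exp (\<theta> \<bullet> x) *\<^sub>R x) - c * exp (\<theta> \<bullet> x))"
    by (auto simp: algebra_simps)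
  note int = first_moment_integrable[OF assms] assms[unfolded mem_domain_iff]
  show "integrable lam (\<lambda>x. exp (\<theta> \<bullet> x) * (v \<bullet> x - c))"
    unfolding eq using int
    by (intro Bochner_Integration.integrable_diff integrable_inner_right integrable_mult_right) auto
  have "(LINT x|lam. v \<bullet> (exp (\<theta> \<bullet> x) *\<^sub>R x) - c * exp (\<theta> \<bullet> x)) =
    (LINT x|lam. v \<bullet> (exp (\<theta> \<bullet> x) *\<^sub>R x)) - (LINT x|lam. c * exp (\<theta> \<bullet> x))"
    using int
    by (intro Bochner_Integration.integral_diff integrable_inner_right integrable_mult_right) auto
  then show "(LINT x|lam. exp (\<theta> \<bullet> x) * (v \<bullet> x - c)) = v \<bullet> first_moment \<theta> - c * partition_fun \<theta>"
    unfolding eq first_moment_def partition_fun_def using int integral_inner_right[of v lam "\<lambda>x. exp (\<theta> \<bullet> x) *\<^sub>R x"]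
    by simp
qed

text \<open>  Pointwise, \<open>exp (h \<bullet> x) - 1 - h \<bullet> x\<close> is at most \<open>(norm h)\<^sup>2\<close> times a function that is integrable
  against \<open>exp (\<theta> \<bullet> x)\<close>. The quadratic bound yields the gradient of the partition function, and the
  Lipschitz bound for the first moment yields continuity of that gradient.\<close>

lemma local_expansion:
  assumes "\<theta> \<in> \<Theta>0"
  obtains \<delta> C where "0 < \<delta>"
    "\<And>h. norm h \<le> \<delta> \<Longrightarrow>
      \<bar>partition_fun (\<theta> + h) - partition_fun \<theta> - h \<bullet> first_moment \<theta>\<bar> \<le> C * (norm h)\<^sup>2"
    "\<And>h. norm h \<le> \<delta> \<Longrightarrow> norm (first_moment (\<theta> + h) - first_moment \<theta>) \<le> C * norm h"
proof -
  obtain \<delta> where \<delta>: "0 < \<delta>" and int: "integrable lam (\<lambda>x. exp (\<theta> \<bullet> x + \<delta> * norm x))"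
    using exp_tilt_norm_integrable[OF assms] .
  obtain r where r: "0 < r" "cball \<theta> r \<subseteq> \<Theta>0"
    using open_domain assms open_contains_cball by blast
  define W where "W x = 8 / \<delta>\<^sup>2 * exp (\<theta> \<bullet> x + \<delta> * norm x)" for x
  have intW: "integrable lam W" unfolding W_def using int by simp
  have W: "exp (\<theta> \<bullet> x) * ((norm x)\<^sup>2 * exp (norm h * norm x)) \<le> W x" if "norm h \<le> \<delta> / 2" for h x :: 'a
    using mult_left_mono[OF square_exp_le[OF \<delta> norm_ge_zero[of x] that], of "exp (\<theta> \<bullet> x)"]
    by (simp add: W_def exp_add mult_ac)
  define C where "C = (LINT x|lam. W x)"
  define d where "d = min (\<delta> / 2) r"
  have d: "0 < d" using \<delta> r by (simp add: d_def)
  have dom: "\<theta> + h \<in> \<Theta>0" if "norm h \<le> d" for h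
    using r that by (auto simp: d_def subset_eq dist_norm)
  have ineq: "\<bar>h \<bullet> x\<bar> \<le> norm h * norm x" for h x :: 'a by (rule Cauchy_Schwarz_ineq2)
  have 1: "\<bar>partition_fun (\<theta> + h) - partition_fun \<theta> - h \<bullet> first_moment \<theta>\<bar> \<le> C * (norm h)\<^sup>2"
    if h: "norm h \<le> d" for h
  proof -
    have ints: "integrable lam (\<lambda>x. exp ((\<theta> + h) \<bullet> x))" "integrable lam (\<lambda>x. exp (\<theta> \<bullet> x))"
      "integrable lam (\<lambda>x. exp (\<theta> \<bullet> x) * (h \<bullet> x))"
      using dom[OF h] assms integral_exp_affine(1)[OF assms, of h 0] by (auto simp: mem_domain_iff)
    let ?g = "\<lambda>x. exp ((\<theta> + h) \<bullet> x) - exp (\<theta> \<bullet> x) - exp (\<theta> \<bullet> x) * (h \<bullet> x)"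
    have eq: "partition_fun (\<theta> + h) - partition_fun \<theta> - h \<bullet> first_moment \<theta> = (LINT x|lam. ?g x)"
      using integral_exp_affine(2)[OF assms, of h 0] ints
      by (simp add: partition_fun_def)
    have "norm (LINT x|lam. ?g x) \<le> (LINT x|lam. (norm h)\<^sup>2 * W x)"
    proof (rule Bochner_Integration.integral_norm_bound_integral)
      fix x :: 'a
      have "?g x = exp (\<theta> \<bullet> x) * (exp (h \<bullet> x) - 1 - h \<bullet> x)"
        by (simp add: inner_add_left exp_add algebra_simps)
      then have "norm (?g x) = exp (\<theta> \<bullet> x) * \<bar>exp (h \<bullet> x) - 1 - h \<bullet> x\<bar>" by (simp add: abs_mult)
      also have "\<dots> \<le> exp (\<theta> \<bullet> x) * ((h \<bullet> x)\<^sup>2 * exp \<bar>h \<bullet> x\<bar>)"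
        by (intro mult_left_mono abs_exp_minus_linear_le) auto
      also have "\<dots> \<le> exp (\<theta> \<bullet> x) * ((norm h * norm x)\<^sup>2 * exp (norm h * norm x))"
        using ineq[of h x] by (intro mult_left_mono mult_mono) (auto simp: abs_le_square_iff[symmetric])
      also have "\<dots> = (norm h)\<^sup>2 * (exp (\<theta> \<bullet> x) * ((norm x)\<^sup>2 * exp (norm h * norm x)))"
        by (simp add: power_mult_distrib mult_ac)
      also have "\<dots> \<le> (norm h)\<^sup>2 * W x"
        using h by (intro mult_left_mono W) (auto simp: d_def)
      finally show "norm (?g x) \<le> (norm h)\<^sup>2 * W x" .
    qed (use ints intW in auto)
    then show ?thesis unfolding eq using intW by (simp add: C_def mult.commute)
  qed
  have 2: "norm (first_moment (\<theta> + h) - first_moment \<theta>) \<le> C * norm h" if h: "norm h \<le> d" for h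
  proof -
    note ints = first_moment_integrable[OF dom[OF h]] first_moment_integrable[OF assms]
    let ?g = "\<lambda>x. exp ((\<theta> + h) \<bullet> x) *\<^sub>R x - exp (\<theta> \<bullet> x) *\<^sub>R x"
    have eq: "first_moment (\<theta> + h) - first_moment \<theta> = (LINT x|lam. ?g x)"
      unfolding first_moment_def using ints by simp
    have "norm (LINT x|lam. ?g x) \<le> (LINT x|lam. norm h * W x)"
    proof (rule Bochner_Integration.integral_norm_bound_integral)
      fix x :: 'a
      have "?g x = (exp (\<theta> \<bullet> x) * (exp (h \<bullet> x) - 1)) *\<^sub>R x"
        by (simp add: inner_add_left exp_add algebra_simps)
      then have "norm (?g x) = exp (\<theta> \<bullet> x) * \<bar>exp (h \<bullet> x) - 1\<bar> * norm x" by (simp add: abs_mult)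
      also have "\<dots> \<le> exp (\<theta> \<bullet> x) * (\<bar>h \<bullet> x\<bar> * exp \<bar>h \<bullet> x\<bar>) * norm x"
        by (intro mult_right_mono mult_left_mono abs_exp_minus_one_le) auto
      also have "\<dots> \<le> exp (\<theta> \<bullet> x) * ((norm h * norm x) * exp (norm h * norm x)) * norm x"
        using ineq[of h x] by (intro mult_right_mono mult_left_mono mult_mono) auto
      also have "\<dots> = norm h * (exp (\<theta> \<bullet> x) * ((norm x)\<^sup>2 * exp (norm h * norm x)))"
        by (simp add: power2_eq_square mult_ac)
      also have "\<dots> \<le> norm h * W x"
        using h by (intro mult_left_mono W) (auto simp: d_def)
      finally show "norm (?g x) \<le> norm h * W x" .
    qed (use ints intW in auto)
    then show ?thesis unfolding eq using intW by (simp add: C_def mult.commute)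
  qed
  show ?thesis by (rule that[OF d 1 2])
qed

lemma GDERIV_kappa:
  assumes "\<theta> \<in> \<Theta>0"
  shows "GDERIV \<kappa> \<theta> :> first_moment \<theta> /\<^sub>R partition_fun \<theta>"
proof -
  obtain \<delta> C where "0 < \<delta>" and b: "\<And>h. norm h \<le> \<delta> \<Longrightarrow>
      \<bar>partition_fun (\<theta> + h) - partition_fun \<theta> - h \<bullet> first_moment \<theta>\<bar> \<le> C * (norm h)\<^sup>2"
    using local_expansion[OF assms] by metis
  then have "GDERIV partition_fun \<theta> :> first_moment \<theta>"
    by (rule GDERIV_of_quadratic_remainder)
  moreover have "DERIV ln (partition_fun \<theta>) :> inverse (partition_fun \<theta>)"
    using partition_fun_pos[OF assms] by (auto intro!: derivative_eq_intros simp: divide_inverse)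
  ultimately have "GDERIV (\<lambda>\<theta>. ln (partition_fun \<theta>)) \<theta> :> inverse (partition_fun \<theta>) *\<^sub>R first_moment \<theta>"
    by (rule GDERIV_DERIV_compose)
  then show ?thesis
    unfolding gderiv_def
    by (rule has_derivative_transform_within_open[OF _ open_domain assms]) (simp add: cgf_eq_ln)
qed

lemma mean_eq: "\<theta> \<in> \<Theta>0 \<Longrightarrow> mean \<theta> = first_moment \<theta> /\<^sub>R partition_fun \<theta>"
  unfolding grad_cgf_def by (intro gradient_eqI GDERIV_kappa)

lemma kappa_has_gradient: "\<theta> \<in> \<Theta>0 \<Longrightarrow> GDERIV \<kappa> \<theta> :> mean \<theta>"
  by (simp add: GDERIV_kappa mean_eq)

lemma continuous_on_kappa: "continuous_on \<Theta>0 \<kappa>"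
  using kappa_has_gradient unfolding gderiv_def
  by (metis continuous_at_imp_continuous_on has_derivative_continuous)

lemma continuous_on_mean: "continuous_on \<Theta>0 mean"
proof -
  have cont: "isCont first_moment \<theta>" "isCont partition_fun \<theta>" if \<theta>: "\<theta> \<in> \<Theta>0" for \<theta>
  proof -
    obtain \<delta> C where \<delta>: "0 < \<delta>" and b: "\<And>h. norm h \<le> \<delta> \<Longrightarrow>
        \<bar>partition_fun (\<theta> + h) - partition_fun \<theta> - h \<bullet> first_moment \<theta>\<bar> \<le> C * (norm h)\<^sup>2"
      and f: "\<And>h. norm h \<le> \<delta> \<Longrightarrow> norm (first_moment (\<theta> + h) - first_moment \<theta>) \<le> C * norm h"
      using local_expansion[OF \<theta>] by metis
    show "isCont partition_fun \<theta>"
      using GDERIV_of_quadratic_remainder[OF \<delta> b] unfolding gderiv_def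
      by (rule has_derivative_continuous)
    have "((\<lambda>h. first_moment (\<theta> + h) - first_moment \<theta>) \<longlongrightarrow> 0) (at 0)"
    proof (rule Lim_null_comparison)
      show "\<forall>\<^sub>F h in at 0. norm (first_moment (\<theta> + h) - first_moment \<theta>) \<le> C * norm h"
        unfolding eventually_at using \<delta> f by (intro exI[of _ \<delta>]) auto
      show "((\<lambda>h. C * norm h) \<longlongrightarrow> 0) (at 0)" by (rule tendsto_eq_intros refl | simp)+
    qed
    then have "((\<lambda>h. first_moment (\<theta> + h)) \<longlongrightarrow> first_moment \<theta>) (at 0)"
      by (simp add: LIM_zero_iff)
    then show "isCont first_moment \<theta>" by (simp add: isCont_iff)
  qed
  have "continuous_on \<Theta>0 (\<lambda>\<theta>. first_moment \<theta> /\<^sub>R partition_fun \<theta>)"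
    using cont partition_fun_pos
    by (intro continuous_intros continuous_at_imp_continuous_on ballI)
      (auto simp: less_imp_neq[symmetric])
  then show ?thesis by (rule continuous_on_eq) (simp add: mean_eq)
qed

lemma integral_exp_affine_mean:
  assumes "\<theta> \<in> \<Theta>0"
  shows "(LINT x|lam. exp (\<theta> \<bullet> x) * (v \<bullet> x - c)) = partition_fun \<theta> * (v \<bullet> mean \<theta> - c)"
  using partition_fun_pos[OF assms]
  unfolding integral_exp_affine(2)[OF assms] mean_eq[OF assms] by (simp add: field_simps)

end

section \<open>Log-likelihood ratios and the inverse of the mean map\<close>

context full_exponential_family
begin

text \<open>  The only way in which non-degeneracy of \<open>lam\<close> enters the strict inequalities below: a nonnegative
  function vanishing only on a hyperplane cannot vanish almost everywhere.\<close>

lemma integral_pos_off_hyperplane: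
  fixes f :: "'a \<Rightarrow> real"
  assumes "v \<noteq> 0" and int: "integrable lam f" and nonneg: "AE x in lam. 0 \<le> f x"
    and zero: "\<And>x. f x = 0 \<Longrightarrow> v \<bullet> x = c"
  shows "0 < (LINT x|lam. f x)"
proof -
  have "(LINT x|lam. f x) \<noteq> 0"
  proof
    assume "(LINT x|lam. f x) = 0"
    then have "AE x in lam. f x = 0" using integral_nonneg_eq_0_iff_AE[OF int nonneg] by simp
    then have "AE x in lam. v \<bullet> x = c" by eventually_elim (rule zero)
    then show False using not_AE_hyperplane[OF \<open>v \<noteq> 0\<close>] by blast
  qed
  then show ?thesis using integral_nonneg_AE[OF nonneg] by simp
qed

text \<open>  The log-likelihood ratio of one observation \<open>s\<close> for the parameter \<open>\<theta>'\<close> against \<open>\<theta>\<close>. For \<open>n\<close>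
  independent observations the ratio is \<open>n\<close> times its value at the sample mean.\<close>

definition llr :: "'a \<Rightarrow> 'a \<Rightarrow> 'a \<Rightarrow> real" where
  "llr \<theta> \<theta>' s = (\<theta>' - \<theta>) \<bullet> s - (\<kappa> \<theta>' - \<kappa> \<theta>)"

lemma llr_same [simp]: "llr \<theta> \<theta> s = 0"
  by (simp add: llr_def)

lemma llr_chain: "llr \<theta> \<theta>' s + llr \<theta>' \<theta>'' s = llr \<theta> \<theta>'' s"
  by (simp add: llr_def algebra_simps)

text \<open>  Strict convexity of \<open>\<kappa>\<close>, in the form \<open>D(\<theta>||\<theta>') > 0\<close>. It is the strict inequality
  \<open>1 + y < exp y\<close> for \<open>y \<noteq> 0\<close>, with \<open>y = (\<theta>' - \<theta>) \<bullet> (x - mean \<theta>)\<close>, integrated against \<open>P\<^bsub>\<theta>\<^esub>\<close>.\<close>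

lemma llr_mean_neg:
  assumes "\<theta> \<in> \<Theta>0" "\<theta>' \<in> \<Theta>0" "\<theta>' \<noteq> \<theta>"
  shows "llr \<theta> \<theta>' (mean \<theta>) < 0"
proof -
  define v where "v = \<theta>' - \<theta>"
  define c where "c = v \<bullet> mean \<theta>"
  \<comment> \<open>\<open>exp y - 1 - y\<close> at \<open>y = v \<bullet> x - c\<close>, multiplied by \<open>exp (\<theta> \<bullet> x)\<close>\<close>
  let ?f = "\<lambda>x. exp (- c) * exp (\<theta>' \<bullet> x) - exp (\<theta> \<bullet> x) - exp (\<theta> \<bullet> x) * (v \<bullet> x - c)"
  have factor: "?f x = exp (\<theta> \<bullet> x) * (exp (v \<bullet> x - c) - 1 - (v \<bullet> x - c))" for x
  proof -
    have "exp (- c) * exp (\<theta>' \<bullet> x) = exp (\<theta> \<bullet> x) * exp (v \<bullet> x - c)"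
      by (simp add: v_def inner_diff_left flip: exp_add)
    then show ?thesis by (simp add: algebra_simps)
  qed
  have ints: "integrable lam (\<lambda>x. exp (\<theta>' \<bullet> x))" "integrable lam (\<lambda>x. exp (\<theta> \<bullet> x))"
    "integrable lam (\<lambda>x. exp (\<theta> \<bullet> x) * (v \<bullet> x - c))"
    using assms integral_exp_affine(1)[OF assms(1)] by (auto simp: mem_domain_iff)
  have "0 < (LINT x|lam. ?f x)"
  proof (rule integral_pos_off_hyperplane)
    show "v \<noteq> 0" using assms by (simp add: v_def)
    show "integrable lam ?f"
      using ints by (intro Bochner_Integration.integrable_diff integrable_mult_right)
    show "AE x in lam. 0 \<le> ?f x"
    proof (rule AE_I2)
      fix x
      show "0 \<le> ?f x"
        unfolding factor using exp_ge_add_one_self[of "v \<bullet> x - c"]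
        by (intro mult_nonneg_nonneg) (simp, linarith)
    qed
    show "v \<bullet> x = c" if "?f x = 0" for x
    proof -
      have "exp (v \<bullet> x - c) - 1 - (v \<bullet> x - c) = 0" using that unfolding factor by simp
      then have "ln (exp (v \<bullet> x - c)) = exp (v \<bullet> x - c) - 1" by simp
      then have "exp (v \<bullet> x - c) = 1" by (intro ln_eq_minus_one) auto
      then show ?thesis by simp
    qed
  qed
  also have "(LINT x|lam. ?f x) = exp (- c) * partition_fun \<theta>' - partition_fun \<theta>"
    using ints integral_exp_affine_mean[OF assms(1), of v c]
    by (simp add: partition_fun_def c_def)
  finally have "exp (\<kappa> \<theta>) < exp (\<kappa> \<theta>' - c)"
    using assms by (simp add: exp_diff exp_minus exp_kappa divide_inverse mult.commute)
  then show ?thesis by (simp add: llr_def c_def v_def)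
qed

lemma llr_mean_nonpos:
  "\<theta> \<in> \<Theta>0 \<Longrightarrow> \<theta>' \<in> \<Theta>0 \<Longrightarrow> llr \<theta> \<theta>' (mean \<theta>) \<le> 0"
  using llr_mean_neg[of \<theta> \<theta>'] by (cases "\<theta>' = \<theta>") auto

text \<open>  A mean never lies on the boundary of a half-space that carries \<open>lam\<close>, since otherwise \<open>lam\<close> would
  be carried by the bounding hyperplane.\<close>

lemma inner_mean_less:
  assumes "v \<noteq> 0" "AE x in lam. v \<bullet> x \<le> c" "\<theta> \<in> \<Theta>0"
  shows "v \<bullet> mean \<theta> < c"
proof -
  have "0 < (LINT x|lam. - (exp (\<theta> \<bullet> x) * (v \<bullet> x - c)))"
  proof (rule integral_pos_off_hyperplane[OF assms(1)])
    show "AE x in lam. 0 \<le> - (exp (\<theta> \<bullet> x) * (v \<bullet> x - c))"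
      using assms(2) by eventually_elim (simp add: mult_le_0_iff)
  qed (use integral_exp_affine(1)[OF assms(3)] in auto)
  then have "partition_fun \<theta> * (v \<bullet> mean \<theta> - c) < 0"
    using integral_exp_affine_mean[OF assms(3), of v c] by simp
  then show ?thesis using partition_fun_pos[OF assms(3)] by (simp add: mult_less_0_iff)
qed

lemma inj_on_mean: "inj_on mean \<Theta>0"
proof (rule inj_onI, rule ccontr)
  fix \<theta> \<theta>' assume *: "\<theta> \<in> \<Theta>0" "\<theta>' \<in> \<Theta>0" "mean \<theta> = mean \<theta>'" "\<theta> \<noteq> \<theta>'"
  then have "llr \<theta> \<theta>' (mean \<theta>) < 0" "llr \<theta>' \<theta> (mean \<theta>) < 0"
    using llr_mean_neg[of \<theta> \<theta>'] llr_mean_neg[of \<theta>' \<theta>] by auto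
  then show False using llr_chain[of \<theta> \<theta>' "mean \<theta>" \<theta>] by simp
qed

lemma open_mean_domain: "open M0"
  unfolding mean_domain_def
  by (intro invariance_of_domain continuous_on_mean open_domain inj_on_mean)

lemma cgf_conj_mean:
  assumes "\<theta> \<in> \<Theta>0"
  shows "cgf_conj lam (mean \<theta>) = ereal (\<theta> \<bullet> mean \<theta> - \<kappa> \<theta>)"
  unfolding cgf_conj_def
proof (rule antisym)
  show "(SUP \<theta>'. ereal (\<theta>' \<bullet> mean \<theta>) - cgf lam \<theta>') \<le> ereal (\<theta> \<bullet> mean \<theta> - \<kappa> \<theta>)"
  proof (rule SUP_least)
    fix \<theta>'
    show "ereal (\<theta>' \<bullet> mean \<theta>) - cgf lam \<theta>' \<le> ereal (\<theta> \<bullet> mean \<theta> - \<kappa> \<theta>)"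
    proof (cases "\<theta>' \<in> \<Theta>0")
      case True
      then show ?thesis using llr_mean_nonpos[OF assms True]
        by (simp add: cgf_eq_ln llr_def algebra_simps)
    qed (simp add: cgf_outside_domain)
  qed
  show "ereal (\<theta> \<bullet> mean \<theta> - \<kappa> \<theta>) \<le> (SUP \<theta>'. ereal (\<theta>' \<bullet> mean \<theta>) - cgf lam \<theta>')"
    by (rule SUP_upper2[of \<theta>]) (auto simp: cgf_eq_ln assms)
qed

text \<open>  The map \<open>\<nabla>\<kappa>\<^sup>*\<close> is the inverse \<open>g\<close> of the mean map: the subgradient inequality at \<open>t\<close> and at \<open>t + h\<close>
  places \<open>\<kappa>\<^sup>* (t + h) - \<kappa>\<^sup>* t - g t \<bullet> h\<close> between \<open>0\<close> and \<open>(g (t + h) - g t) \<bullet> h\<close>, which is \<open>o(h)\<close> as \<open>g\<close> is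
  continuous.\<close>

lemma mean_inverse:
  shows grad_conj_mean: "\<theta> \<in> \<Theta>0 \<Longrightarrow> grad_conj lam (mean \<theta>) = \<theta>"
    and continuous_on_grad_conj: "continuous_on M0 (grad_conj lam)"
proof -
  obtain g where "homeomorphism \<Theta>0 (mean ` \<Theta>0) mean g"
    using invariance_of_domain_homeomorphism[OF open_domain continuous_on_mean _ inj_on_mean] by auto
  then have g_cont: "continuous_on M0 g" and g_mean: "\<And>\<theta>. \<theta> \<in> \<Theta>0 \<Longrightarrow> g (mean \<theta>) = \<theta>"
    and mean_g: "\<And>t. t \<in> M0 \<Longrightarrow> mean (g t) = t" and g_mem: "\<And>t. t \<in> M0 \<Longrightarrow> g t \<in> \<Theta>0"
    by (auto simp: homeomorphism_def mean_domain_def)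
  define conj where "conj s = real_of_ereal (cgf_conj lam s)" for s
  have conj_eq: "conj s = g s \<bullet> s - \<kappa> (g s)" if "s \<in> M0" for s
    using cgf_conj_mean[OF g_mem[OF that]] by (simp add: conj_def mean_g[OF that])
  have sub: "conj s + g s \<bullet> (s' - s) \<le> conj s'" if "s \<in> M0" "s' \<in> M0" for s s'
    using llr_mean_nonpos[OF g_mem[OF that(2)] g_mem[OF that(1)]] that
    by (simp add: conj_eq mean_g llr_def algebra_simps)
  have "GDERIV conj t :> g t" if t: "t \<in> M0" for t
    unfolding gderiv_def has_derivative_at
  proof (intro conjI)
    have g_lim: "((\<lambda>h. norm (g (t + h) - g t)) \<longlongrightarrow> 0) (at 0)"
      using g_cont t open_mean_domain
      by (simp add: continuous_on_eq_continuous_at isCont_iff LIM_zero_iff tendsto_norm_zero)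
    have "((\<lambda>h. t + h) \<longlongrightarrow> t + 0) (at 0)" by (intro tendsto_intros)
    then have ev: "\<forall>\<^sub>F h in at 0. t + h \<in> M0"
      using topological_tendstoD[of "\<lambda>h. t + h" "t + 0" "at 0", OF _ open_mean_domain] t by simp
    show "(\<lambda>h. norm (conj (t + h) - conj t - h \<bullet> g t) / norm h) \<midarrow>0\<rightarrow> 0"
    proof (rule Lim_null_comparison[OF _ g_lim])
      show "\<forall>\<^sub>F h in at 0. norm (norm (conj (t + h) - conj t - h \<bullet> g t) / norm h)
          \<le> norm (g (t + h) - g t)"
        using ev
      proof eventually_elim
        case (elim h)
        have "\<bar>conj (t + h) - conj t - h \<bullet> g t\<bar> \<le> (g (t + h) - g t) \<bullet> h"
          using sub[OF t elim] sub[OF elim t] by (simp add: algebra_simps inner_commute)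
        also have "\<dots> \<le> norm (g (t + h) - g t) * norm h" by (rule norm_cauchy_schwarz)
        finally show ?case by (cases "h = 0") (auto simp: divide_simps)
      qed
    qed
  qed (rule bounded_linear_inner_left)
  then have grad: "grad_conj lam t = g t" if "t \<in> M0" for t
    using gradient_eqI[of conj t "g t"] that by (simp add: grad_conj_def conj_def[abs_def])
  show "\<theta> \<in> \<Theta>0 \<Longrightarrow> grad_conj lam (mean \<theta>) = \<theta>"
    by (simp add: grad mean_domain_def g_mean)
  show "continuous_on M0 (grad_conj lam)"
    using g_cont by (rule continuous_on_eq) (simp add: grad)
qed

abbreviation "natural \<equiv> grad_conj lam"

lemma mean_mem: "\<theta> \<in> \<Theta>0 \<Longrightarrow> mean \<theta> \<in> M0"
  by (simp add: mean_domain_def)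

lemma natural_mem: "t \<in> M0 \<Longrightarrow> natural t \<in> \<Theta>0"
  by (auto simp: mean_domain_def grad_conj_mean)

lemma mean_natural: "t \<in> M0 \<Longrightarrow> mean (natural t) = t"
  by (auto simp: mean_domain_def grad_conj_mean)

text \<open>  The likelihood at \<open>t\<close> is maximal at the parameter with mean \<open>t\<close>, whatever the reference \<open>\<theta>\<close>.\<close>

lemma llr_le_llr_natural:
  assumes "t \<in> M0" "\<theta>' \<in> \<Theta>0"
  shows "llr \<theta> \<theta>' t \<le> llr \<theta> (natural t) t"
  using llr_mean_nonpos[OF natural_mem[OF assms(1)] assms(2)] llr_chain[of \<theta> "natural t" t \<theta>']
  by (simp add: mean_natural[OF assms(1)])

lemma KL_div_eq:
  assumes "\<theta>\<^sub>1 \<in> \<Theta>0" "\<theta>\<^sub>2 \<in> \<Theta>0"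
  shows "KL_div lam \<theta>\<^sub>1 \<theta>\<^sub>2 = llr \<theta>\<^sub>2 \<theta>\<^sub>1 (mean \<theta>\<^sub>1)"
proof -
  interpret sigma_finite_measure lam by (rule sigma_finite_lam)
  let ?p = "\<lambda>\<theta> x. exp (\<theta> \<bullet> x - \<kappa> \<theta>)"
  have "KL_div lam \<theta>\<^sub>1 \<theta>\<^sub>2 = (LINT x|lam. ?p \<theta>\<^sub>1 x * log (exp 1) (?p \<theta>\<^sub>1 x / ?p \<theta>\<^sub>2 x))"
    unfolding KL_div_def exp_fam_def by (rule KL_density_density) auto
  also have "\<dots> = (LINT x|lam. exp (- \<kappa> \<theta>\<^sub>1) *
      (exp (\<theta>\<^sub>1 \<bullet> x) * ((\<theta>\<^sub>1 - \<theta>\<^sub>2) \<bullet> x - (\<kappa> \<theta>\<^sub>1 - \<kappa> \<theta>\<^sub>2))))"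
  proof (intro Bochner_Integration.integral_cong refl)
    fix x
    have "?p \<theta>\<^sub>1 x / ?p \<theta>\<^sub>2 x = exp ((\<theta>\<^sub>1 - \<theta>\<^sub>2) \<bullet> x - (\<kappa> \<theta>\<^sub>1 - \<kappa> \<theta>\<^sub>2))"
      by (simp add: inner_diff_left algebra_simps flip: exp_diff)
    then have "log (exp 1) (?p \<theta>\<^sub>1 x / ?p \<theta>\<^sub>2 x) = (\<theta>\<^sub>1 - \<theta>\<^sub>2) \<bullet> x - (\<kappa> \<theta>\<^sub>1 - \<kappa> \<theta>\<^sub>2)"
      by (simp add: log_def)
    moreover have "?p \<theta>\<^sub>1 x = exp (- \<kappa> \<theta>\<^sub>1) * exp (\<theta>\<^sub>1 \<bullet> x)"
      by (simp flip: exp_add)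
    ultimately show "?p \<theta>\<^sub>1 x * log (exp 1) (?p \<theta>\<^sub>1 x / ?p \<theta>\<^sub>2 x) = exp (- \<kappa> \<theta>\<^sub>1) *
      (exp (\<theta>\<^sub>1 \<bullet> x) * ((\<theta>\<^sub>1 - \<theta>\<^sub>2) \<bullet> x - (\<kappa> \<theta>\<^sub>1 - \<kappa> \<theta>\<^sub>2)))"
      by simp
  qed
  also have "\<dots> = exp (- \<kappa> \<theta>\<^sub>1) * (partition_fun \<theta>\<^sub>1 * llr \<theta>\<^sub>2 \<theta>\<^sub>1 (mean \<theta>\<^sub>1))"
    using integral_exp_affine(1)[OF assms(1)] integral_exp_affine_mean[OF assms(1)]
    by (simp add: llr_def)
  also have "\<dots> = llr \<theta>\<^sub>2 \<theta>\<^sub>1 (mean \<theta>\<^sub>1)"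
    using assms partition_fun_pos[OF assms(1)] by (simp add: exp_minus exp_kappa)
  finally show ?thesis .
qed

lemma KL_div_natural:
  assumes "t \<in> M0" "\<theta> \<in> \<Theta>0"
  shows "KL_div lam (natural t) \<theta> = llr \<theta> (natural t) t"
  using assms by (simp add: KL_div_eq natural_mem mean_natural)

section \<open>Existence of maximum likelihood estimates\<close>

lemma nn_integral_exp_shift:
  assumes "\<theta> \<in> \<Theta>0"
  shows "(\<integral>\<^sup>+ x. ennreal (exp (\<theta> \<bullet> (x - t))) \<partial>lam) = ennreal (exp (\<kappa> \<theta> - \<theta> \<bullet> t))"
proof -
  have "(\<integral>\<^sup>+ x. ennreal (exp (\<theta> \<bullet> (x - t))) \<partial>lam) =
      (\<integral>\<^sup>+ x. ennreal (exp (- (\<theta> \<bullet> t))) * ennreal (exp (\<theta> \<bullet> x)) \<partial>lam)"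
    by (intro nn_integral_cong) (simp add: inner_diff_right flip: ennreal_mult exp_add)
  also have "\<dots> = ennreal (exp (- (\<theta> \<bullet> t))) * ennreal (partition_fun \<theta>)"
    by (simp add: nn_integral_cmult nn_integral_exp_inner assms)
  also have "\<dots> = ennreal (exp (\<kappa> \<theta> - \<theta> \<bullet> t))"
    using partition_fun_pos[OF assms]
    by (simp add: exp_diff exp_kappa assms exp_minus field_simps flip: ennreal_mult)
  finally show ?thesis .
qed

lemma mem_domain_shift_iff:
  "\<theta> \<in> \<Theta>0 \<longleftrightarrow> (\<integral>\<^sup>+ x. ennreal (exp (\<theta> \<bullet> (x - t))) \<partial>lam) < \<infinity>"
proof -
  have "(\<integral>\<^sup>+ x. ennreal (exp (\<theta> \<bullet> x)) \<partial>lam) =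
      (\<integral>\<^sup>+ x. ennreal (exp (\<theta> \<bullet> t)) * ennreal (exp (\<theta> \<bullet> (x - t))) \<partial>lam)"
    by (intro nn_integral_cong) (simp add: inner_diff_right flip: ennreal_mult exp_add)
  then have "(\<integral>\<^sup>+ x. ennreal (exp (\<theta> \<bullet> x)) \<partial>lam) =
      ennreal (exp (\<theta> \<bullet> t)) * (\<integral>\<^sup>+ x. ennreal (exp (\<theta> \<bullet> (x - t))) \<partial>lam)"
    by (simp add: nn_integral_cmult)
  then show ?thesis
    using mem_domain_iff[of \<theta>] nn_integral_exp_shift[of \<theta> t]
    by (auto simp: integrable_iff_bounded ennreal_mult_less_top)
qed

text \<open>  The parameters under which the log-likelihood at \<open>t\<close> is at least \<open>-a\<close>. In the form
  \<open>dual_sublevel_eq\<close> these sets are amenable to Fatou's lemma.\<close>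

definition dual_sublevel :: "'a \<Rightarrow> real \<Rightarrow> 'a set" where
  "dual_sublevel t a = {\<theta> \<in> \<Theta>0. \<kappa> \<theta> - \<theta> \<bullet> t \<le> a}"

lemma dual_sublevel_eq:
  "dual_sublevel t a = {\<theta>. (\<integral>\<^sup>+ x. ennreal (exp (\<theta> \<bullet> (x - t))) \<partial>lam) \<le> ennreal (exp a)}"
proof -
  have dom: "\<theta> \<in> \<Theta>0" if "(\<integral>\<^sup>+ x. ennreal (exp (\<theta> \<bullet> (x - t))) \<partial>lam) \<le> ennreal (exp a)" for \<theta>
    using that mem_domain_shift_iff[of \<theta> t] by (metis ennreal_less_top infinity_ennreal_def order_le_less_trans)
  have "(\<integral>\<^sup>+ x. ennreal (exp (\<theta> \<bullet> (x - t))) \<partial>lam) \<le> ennreal (exp a) \<longleftrightarrow> \<kappa> \<theta> - \<theta> \<bullet> t \<le> a"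
    if "\<theta> \<in> \<Theta>0" for \<theta>
    unfolding nn_integral_exp_shift[OF that] by simp
  with dom show ?thesis
    unfolding dual_sublevel_def by blast
qed

lemma fatou_exp:
  assumes "\<And>n. \<theta> n \<in> dual_sublevel t a"
  shows "(\<integral>\<^sup>+ x. liminf (\<lambda>n. ennreal (exp (\<theta> n \<bullet> (x - t)))) \<partial>lam) \<le> ennreal (exp a)"
proof -
  have "(\<integral>\<^sup>+ x. liminf (\<lambda>n. ennreal (exp (\<theta> n \<bullet> (x - t)))) \<partial>lam)
      \<le> liminf (\<lambda>n. \<integral>\<^sup>+ x. ennreal (exp (\<theta> n \<bullet> (x - t))) \<partial>lam)"
    by (intro nn_integral_liminf) measurable
  also have "\<dots> \<le> liminf (\<lambda>n. ennreal (exp a))"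
    using assms by (intro Liminf_mono always_eventually) (auto simp: dual_sublevel_eq)
  finally show ?thesis by (simp add: Liminf_const)
qed

lemma closed_dual_sublevel: "closed (dual_sublevel t a)"
  unfolding closed_sequential_limits
proof (intro allI impI)
  fix \<theta> l assume *: "(\<forall>n. \<theta> n \<in> dual_sublevel t a) \<and> \<theta> \<longlonglongrightarrow> l"
  have "liminf (\<lambda>n. ennreal (exp (\<theta> n \<bullet> (x - t)))) = ennreal (exp (l \<bullet> (x - t)))" for x
    using * by (intro lim_imp_Liminf tendsto_ennrealI tendsto_intros) auto
  then show "l \<in> dual_sublevel t a"
    using fatou_exp[of \<theta> t a] * by (simp add: dual_sublevel_eq)
qed

text \<open>  Take \<open>\<theta>\<^sub>n\<close> in the set with norms tending to infinity and directions tending to \<open>v\<close>. Where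
  \<open>v \<bullet> (x - t) > 0\<close> the integrands \<open>exp (\<theta>\<^sub>n \<bullet> (x - t))\<close> tend to infinity while their integrals stay
  bounded, so by Fatou this region is null.\<close>

lemma unbounded_dual_sublevel_imp_halfspace:
  assumes "\<not> bounded (dual_sublevel t a)"
  obtains v where "v \<noteq> 0" "AE x in lam. v \<bullet> x \<le> v \<bullet> t"
proof -
  have "\<exists>\<theta>. \<theta> \<in> dual_sublevel t a \<and> real (Suc n) < norm \<theta>" for n
    using assms unfolding bounded_iff by (meson linorder_not_le)
  then obtain \<theta> where \<theta>: "\<And>n. \<theta> n \<in> dual_sublevel t a" "\<And>n. real (Suc n) < norm (\<theta> n)" by metis
  have pos: "0 < norm (\<theta> n)" for n using \<theta>(2)[of n] by linarith
  define u where "u n = \<theta> n /\<^sub>R norm (\<theta> n)" for n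
  have "\<forall>n. u n \<in> sphere 0 1" using pos by (simp add: u_def)
  then obtain v r where v: "v \<in> sphere 0 1" and r: "strict_mono r" "(u \<circ> r) \<longlonglongrightarrow> v"
    using compact_sphere[of "0::'a" 1] unfolding compact_def by metis
  have norm_lim: "filterlim (\<lambda>n. norm (\<theta> (r n))) at_top sequentially"
  proof (rule filterlim_at_top_mono[OF filterlim_real_sequentially])
    show "\<forall>\<^sub>F n in sequentially. real n \<le> norm (\<theta> (r n))"
      using \<theta>(2) seq_suble[OF r(1)] by (intro always_eventually allI)
        (smt (verit, best) of_nat_Suc of_nat_mono)
  qed
  have inf: "liminf (\<lambda>n. ennreal (exp (\<theta> (r n) \<bullet> (x - t)))) = \<infinity>" if x: "0 < v \<bullet> (x - t)" for x
  proof -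
    have "(\<lambda>n. u (r n) \<bullet> (x - t)) \<longlonglongrightarrow> v \<bullet> (x - t)"
      using r(2) by (intro tendsto_intros) (simp add: o_def)
    from filterlim_tendsto_pos_mult_at_top[OF this x norm_lim]
    have "filterlim (\<lambda>n. \<theta> (r n) \<bullet> (x - t)) at_top sequentially"
      using pos by (simp add: u_def field_simps less_imp_neq[symmetric])
    from filterlim_compose[OF exp_at_top this]
    have "(\<lambda>n. ennreal (exp (\<theta> (r n) \<bullet> (x - t)))) \<longlonglongrightarrow> \<infinity>"
      by (simp add: ennreal_tendsto_top_eq_at_top)
    then show ?thesis by (intro lim_imp_Liminf) auto
  qed
  have "(\<integral>\<^sup>+ x. liminf (\<lambda>n. ennreal (exp (\<theta> (r n) \<bullet> (x - t)))) \<partial>lam) \<noteq> \<infinity>"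
    using le_less_trans[OF fatou_exp[of "\<theta> \<circ> r" t a] ennreal_less_top] \<theta>(1) by (simp add: less_top)
  then have "AE x in lam. liminf (\<lambda>n. ennreal (exp (\<theta> (r n) \<bullet> (x - t)))) \<noteq> \<infinity>"
    by (intro nn_integral_PInf_AE) measurable
  then have "AE x in lam. v \<bullet> x \<le> v \<bullet> t"
    by eventually_elim (use inf in \<open>auto simp: inner_diff_right not_less[symmetric]\<close>)
  moreover have "v \<noteq> 0" using v by auto
  ultimately show ?thesis using that by blast
qed

lemma compact_dual_sublevel:
  assumes "t \<in> M0"
  shows "compact (dual_sublevel t a)"
proof -
  obtain \<theta> where \<theta>: "\<theta> \<in> \<Theta>0" "t = mean \<theta>" using assms by (auto simp: mean_domain_def)
  have "bounded (dual_sublevel t a)"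
    using unbounded_dual_sublevel_imp_halfspace inner_mean_less[OF _ _ \<theta>(1)] \<theta>(2)
    by (metis order_less_irrefl)
  then show ?thesis using closed_dual_sublevel by (simp add: compact_eq_bounded_closed)
qed

text \<open>  Constrained maximum likelihood at \<open>t\<close>. A sublevel set is compact inside the open
  domain, so a relatively closed constraint set meets it in a compact set.\<close>

lemma exists_dual_minimizer:
  assumes compact: "\<And>a. compact (dual_sublevel t a)"
    and S: "closedin (top_of_set \<Theta>0) S" "S \<noteq> {}"
  obtains \<theta> where "\<theta> \<in> S" "\<And>\<theta>'. \<theta>' \<in> S \<Longrightarrow> \<kappa> \<theta> - \<theta> \<bullet> t \<le> \<kappa> \<theta>' - \<theta>' \<bullet> t"
proof -
  obtain \<theta>\<^sub>1 where \<theta>\<^sub>1: "\<theta>\<^sub>1 \<in> S" using S by auto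
  have sub: "S \<subseteq> \<Theta>0" using S closedin_subset by force
  obtain T where T: "closed T" "S = \<Theta>0 \<inter> T" using S(1) by (auto simp: closedin_closed)
  \<comment> \<open>points no worse than some \<open>\<theta>\<^sub>1 \<in> S\<close>\<close>
  define K where "K = T \<inter> dual_sublevel t (\<kappa> \<theta>\<^sub>1 - \<theta>\<^sub>1 \<bullet> t)"
  have K_sub: "K \<subseteq> S" using T by (auto simp: K_def dual_sublevel_def)
  have mem_K: "\<theta> \<in> K" if "\<theta> \<in> S" "\<kappa> \<theta> - \<theta> \<bullet> t \<le> \<kappa> \<theta>\<^sub>1 - \<theta>\<^sub>1 \<bullet> t" for \<theta>
    using that T by (auto simp: K_def dual_sublevel_def)
  have "compact K" unfolding K_def by (intro closed_Int_compact T compact)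
  moreover have "K \<noteq> {}" using mem_K \<theta>\<^sub>1 by blast
  moreover have "continuous_on K (\<lambda>\<theta>. \<kappa> \<theta> - \<theta> \<bullet> t)"
    using K_sub sub by (intro continuous_intros continuous_on_subset[OF continuous_on_kappa]) auto
  ultimately obtain \<theta> where \<theta>: "\<theta> \<in> K" "\<And>\<theta>'. \<theta>' \<in> K \<Longrightarrow> \<kappa> \<theta> - \<theta> \<bullet> t \<le> \<kappa> \<theta>' - \<theta>' \<bullet> t"
    using continuous_attains_inf[of K "\<lambda>\<theta>. \<kappa> \<theta> - \<theta> \<bullet> t"] by blast
  show ?thesis
  proof (rule that)
    show "\<theta> \<in> S" using \<theta> K_sub by auto
    fix \<theta>' assume \<theta>': "\<theta>' \<in> S"
    show "\<kappa> \<theta> - \<theta> \<bullet> t \<le> \<kappa> \<theta>' - \<theta>' \<bullet> t"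
    proof (rule ccontr)
      assume *: "\<not> ?thesis"
      then have "\<theta>' \<in> K" using \<theta>(1) \<theta>' by (intro mem_K) (auto simp: K_def dual_sublevel_def)
      then show False using * \<theta>(2) by blast
    qed
  qed
qed

lemma GDERIV_dual:
  assumes "\<theta> \<in> \<Theta>0"
  shows "GDERIV (\<lambda>\<theta>. \<kappa> \<theta> - \<theta> \<bullet> t) \<theta> :> mean \<theta> - t"
proof -
  have "GDERIV (\<lambda>\<theta>. \<theta> \<bullet> t) \<theta> :> t"
    unfolding gderiv_def by (auto intro!: derivative_eq_intros)
  then show ?thesis by (rule GDERIV_diff[OF kappa_has_gradient[OF assms]])
qed

lemma mean_eq_of_dual_minimizer:
  assumes \<theta>: "\<theta> \<in> \<Theta>0" and min: "\<And>\<theta>'. \<theta>' \<in> \<Theta>0 \<Longrightarrow> \<kappa> \<theta> - \<theta> \<bullet> t \<le> \<kappa> \<theta>' - \<theta>' \<bullet> t"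
  shows "mean \<theta> = t"
proof -
  have "(\<lambda>h. h \<bullet> (mean \<theta> - t)) = (\<lambda>h. 0)"
    using GDERIV_dual[OF \<theta>, of t] min unfolding gderiv_def
    by (intro differential_zero_maxmin[OF \<theta> open_domain]) auto
  then have "(mean \<theta> - t) \<bullet> (mean \<theta> - t) = 0" by metis
  then show ?thesis by simp
qed

text \<open>  Otherwise all sublevel sets would be compact, \<open>\<kappa> \<theta> - \<theta> \<bullet> t\<close> would have a minimiser in the open
  domain, and \<open>t\<close> would be the mean of that minimiser.\<close>

lemma halfspace_of_notin_mean_domain:
  assumes "t \<notin> M0" "\<Theta>0 \<noteq> {}"
  obtains v where "v \<noteq> 0" "AE x in lam. v \<bullet> x \<le> v \<bullet> t"
proof -
  have "\<exists>a. \<not> bounded (dual_sublevel t a)"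
  proof (rule ccontr)
    assume "\<not> ?thesis"
    then have "compact (dual_sublevel t a)" for a
      using closed_dual_sublevel by (simp add: compact_eq_bounded_closed)
    then obtain \<theta> where "\<theta> \<in> \<Theta>0" "\<And>\<theta>'. \<theta>' \<in> \<Theta>0 \<Longrightarrow> \<kappa> \<theta> - \<theta> \<bullet> t \<le> \<kappa> \<theta>' - \<theta>' \<bullet> t"
      using exists_dual_minimizer[of t \<Theta>0] assms(2) by auto
    then have "t \<in> M0" using mean_eq_of_dual_minimizer mean_mem by metis
    then show False using assms(1) by simp
  qed
  then show ?thesis using unbounded_dual_sublevel_imp_halfspace that by metis
qed

text \<open>  With \<open>v \<bullet> x \<le> v \<bullet> t\<close> almost everywhere, the inequality is strict on \<open>M0\<close> by \<open>inner_mean_less\<close>, hence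
  almost everywhere. Then the integral of \<open>exp ((\<theta> + n v) \<bullet> (x - t))\<close> tends to \<open>0\<close> by dominated
  convergence, so the likelihood at \<open>t\<close> tends to infinity along \<open>\<theta> + n v\<close>.\<close>

lemma llr_unbounded_off_mean_domain:
  assumes M0: "AE x in lam. x \<in> M0" and t: "t \<notin> M0" and \<theta>: "\<theta> \<in> \<Theta>0"
  obtains \<theta>' where "\<theta>' \<in> \<Theta>0" "a < llr \<theta> \<theta>' t"
proof -
  obtain v where v: "v \<noteq> 0" "AE x in lam. v \<bullet> x \<le> v \<bullet> t"
    using halfspace_of_notin_mean_domain[OF t] \<theta> by blast
  have strict: "AE x in lam. v \<bullet> (x - t) < 0"
    using M0
  proof eventually_elim
    case (elim x)
    then show ?case using inner_mean_less[OF v] by (auto simp: mean_domain_def inner_diff_right)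
  qed
  define \<theta>' where "\<theta>' n = \<theta> + real n *\<^sub>R v" for n
  let ?f = "\<lambda>n x. exp (\<theta>' n \<bullet> (x - t))"
  have dom: "AE x in lam. norm (?f n x) \<le> exp (\<theta> \<bullet> (x - t))" for n
    using strict
  proof eventually_elim
    case (elim x)
    have "real n * (v \<bullet> (x - t)) \<le> 0" using elim by (simp add: mult_nonneg_nonpos)
    then show ?case by (simp add: \<theta>'_def inner_add_left)
  qed
  have ne: "(\<integral>\<^sup>+ x. ennreal (exp (\<theta> \<bullet> (x - t))) \<partial>lam) < \<infinity>" using \<theta> mem_domain_shift_iff by blast
  then have int: "integrable lam (\<lambda>x. exp (\<theta> \<bullet> (x - t)))" by (simp add: integrable_iff_bounded)
  have int_n: "integrable lam (?f n)" for n
    by (rule Bochner_Integration.integrable_bound[OF int]) (use dom[of n] in auto)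
  have \<theta>'_mem: "\<theta>' n \<in> \<Theta>0" for n
    using int_n[of n] mem_domain_shift_iff[of "\<theta>' n" t] by (simp add: integrable_iff_bounded)
  have "(\<lambda>n. LINT x|lam. ?f n x) \<longlonglongrightarrow> (LINT x|lam. 0)"
  proof (rule integral_dominated_convergence)
    show "AE x in lam. (\<lambda>n. ?f n x) \<longlonglongrightarrow> 0"
      using strict
    proof eventually_elim
      case (elim x)
      have "(\<lambda>n. exp (\<theta> \<bullet> (x - t)) * exp (v \<bullet> (x - t)) ^ n) \<longlonglongrightarrow> exp (\<theta> \<bullet> (x - t)) * 0"
        using elim by (intro tendsto_intros LIMSEQ_power_zero) auto
      then show ?case
        by (simp add: \<theta>'_def inner_add_left exp_add exp_of_nat_mult)
    qed
  qed (use int dom in auto)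
  then have lim: "(\<lambda>n. LINT x|lam. ?f n x) \<longlonglongrightarrow> 0" by simp
  have "(LINT x|lam. ?f n x) = exp (\<kappa> (\<theta>' n) - \<theta>' n \<bullet> t)" for n
    using nn_integral_eq_integral[OF int_n[of n]] nn_integral_exp_shift[OF \<theta>'_mem[of n], of t]
    by (simp add: ennreal_inj)
  with lim have "(\<lambda>n. exp (\<kappa> (\<theta>' n) - \<theta>' n \<bullet> t)) \<longlonglongrightarrow> 0" by simp
  then have "\<forall>\<^sub>F n in sequentially. exp (\<kappa> (\<theta>' n) - \<theta>' n \<bullet> t) < exp (\<kappa> \<theta> - \<theta> \<bullet> t - a)"
    by (rule order_tendstoD) simp
  then obtain n where "exp (\<kappa> (\<theta>' n) - \<theta>' n \<bullet> t) < exp (\<kappa> \<theta> - \<theta> \<bullet> t - a)"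
    by (meson eventually_happens trivial_limit_sequentially)
  then have "a < llr \<theta> (\<theta>' n) t" by (simp add: llr_def inner_diff_left)
  then show ?thesis using that \<theta>'_mem by blast
qed

end

section \<open>Normal cones and the constrained estimator\<close>

lemma admissible_cone_closed_convex_cone:
  "closed (admissible_cone \<Theta> \<theta>) \<and> convex_cone (admissible_cone \<Theta> \<theta>)"
  unfolding admissible_cone_def
  by (rule hull_in) (auto intro: closed_Inter convex_cone_Inter)

text \<open>  Half-spaces through the origin are closed convex cones, so the polar of the generated cone is the
  polar of its generators.\<close>

lemma mem_normal_cone_iff:
  "v \<in> normal_cone \<Theta> \<theta> \<longleftrightarrow> (\<forall>u\<in>admissible_directions \<Theta> \<theta>. u \<bullet> v \<le> 0)"
proof -
  have "admissible_cone \<Theta> \<theta> \<subseteq> {w. v \<bullet> w \<le> 0} \<longleftrightarrow> admissible_directions \<Theta> \<theta> \<subseteq> {w. v \<bullet> w \<le> 0}"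
    unfolding admissible_cone_def
    by (rule subset_hull) (simp add: closed_halfspace_le convex_cone_halfspace_le)
  then show ?thesis by (auto simp: normal_cone_def inner_commute)
qed

lemma zero_mem_normal_cone: "0 \<in> normal_cone \<Theta> \<theta>"
  by (simp add: normal_cone_def)

text \<open>  The bipolar theorem for closed convex cones: a hyperplane separating the point from the cone can
  be moved to pass through the origin, because scaling would otherwise violate the separation.\<close>

lemma exists_normal_separating:
  assumes "x \<notin> admissible_cone \<Theta> \<theta>"
  obtains v where "v \<in> normal_cone \<Theta> \<theta>" "0 < x \<bullet> v"
proof -
  let ?A = "admissible_cone \<Theta> \<theta>"
  have cone: "closed ?A" "convex_cone ?A" using admissible_cone_closed_convex_cone by auto
  then obtain a b where ab: "a \<bullet> x < b" "\<And>w. w \<in> ?A \<Longrightarrow> b < a \<bullet> w"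
    using separating_hyperplane_closed_point[of ?A x] assms by (auto simp: convex_cone_def)
  have b: "b < 0" using ab(2)[OF convex_cone_contains_0[OF cone(2)]] by simp
  have "0 \<le> a \<bullet> w" if w: "w \<in> ?A" for w
  proof (rule ccontr)
    assume neg: "\<not> 0 \<le> a \<bullet> w"
    then have "(b / (a \<bullet> w)) *\<^sub>R w \<in> ?A"
      using b by (intro convex_cone_scaleR[OF cone(2) _ w]) (simp add: zero_le_divide_iff)
    from ab(2)[OF this] show False using neg by simp
  qed
  then have "- a \<in> normal_cone \<Theta> \<theta>"
    by (simp add: normal_cone_def inner_commute)
  moreover have "0 < x \<bullet> (- a)" using ab(1) b by (simp add: inner_commute)
  ultimately show ?thesis by (rule that)
qed

text \<open>  Along a sequence in \<open>\<Theta>\<close> approaching \<open>\<theta>\<close> from direction \<open>u\<close>, the difference quotients of \<open>f\<close> are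
  nonnegative and converge to \<open>u \<bullet> D\<close>.\<close>

lemma first_order_condition:
  assumes min: "\<And>y. y \<in> \<Theta> \<Longrightarrow> f \<theta> \<le> f y" and grad: "GDERIV f \<theta> :> D"
  shows "- D \<in> normal_cone \<Theta> \<theta>"
  unfolding mem_normal_cone_iff
proof
  fix u assume "u \<in> admissible_directions \<Theta> \<theta>"
  then obtain s r where s: "\<And>n. s n \<in> \<Theta> \<and> s n \<noteq> \<theta>" "s \<longlonglongrightarrow> \<theta>" and r: "strict_mono (r :: nat \<Rightarrow> nat)"
    and u: "(\<lambda>n. (s (r n) - \<theta>) /\<^sub>R norm (s (r n) - \<theta>)) \<longlonglongrightarrow> u"
    by (auto simp: admissible_directions_def)
  have "(s \<circ> r) \<longlonglongrightarrow> \<theta>" using s(2) r by (rule LIMSEQ_subseq_LIMSEQ)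
  then have "filterlim (\<lambda>n. s (r n)) (at \<theta>) sequentially"
    using s(1) by (auto simp: filterlim_at o_def)
  from filterlim_compose[OF GDERIV_remainder_tendsto[OF grad] this]
  have "(\<lambda>n. (f (s (r n)) - f \<theta> - (s (r n) - \<theta>) \<bullet> D) / norm (s (r n) - \<theta>)) \<longlonglongrightarrow> 0" .
  moreover have "(\<lambda>n. ((s (r n) - \<theta>) /\<^sub>R norm (s (r n) - \<theta>)) \<bullet> D) \<longlonglongrightarrow> u \<bullet> D"
    by (intro tendsto_intros u)
  ultimately have "(\<lambda>n. (f (s (r n)) - f \<theta> - (s (r n) - \<theta>) \<bullet> D) / norm (s (r n) - \<theta>) +
      ((s (r n) - \<theta>) /\<^sub>R norm (s (r n) - \<theta>)) \<bullet> D) \<longlonglongrightarrow> 0 + u \<bullet> D"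
    by (rule tendsto_add)
  moreover have "0 \<le> (f (s (r n)) - f \<theta> - (s (r n) - \<theta>) \<bullet> D) / norm (s (r n) - \<theta>) +
      ((s (r n) - \<theta>) /\<^sub>R norm (s (r n) - \<theta>)) \<bullet> D" for n
  proof -
    have "(f (s (r n)) - f \<theta> - (s (r n) - \<theta>) \<bullet> D) / norm (s (r n) - \<theta>) +
      ((s (r n) - \<theta>) /\<^sub>R norm (s (r n) - \<theta>)) \<bullet> D = (f (s (r n)) - f \<theta>) / norm (s (r n) - \<theta>)"
      by (simp add: divide_inverse algebra_simps)
    then show ?thesis using min[of "s (r n)"] s(1) by simp
  qed
  ultimately have "0 \<le> u \<bullet> D" by (intro LIMSEQ_le_const) auto
  then show "u \<bullet> (- D) \<le> 0" by simp
qed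

text \<open>  The sets \<open>B_set lam \<Theta> \<theta>\<close> partition the mean domain with \<open>\<phi>\<close> selecting the cell; the two
  assumptions on the range and the fibres of \<open>\<phi>\<close> encode this.\<close>

locale normal_cone_partition = full_exponential_family lam
  for lam :: "'a::euclidean_space measure" +
  fixes \<Theta> :: "'a set" and \<phi> :: "'a \<Rightarrow> 'a"
  assumes Theta_closed: "closedin (top_of_set \<Theta>0) \<Theta>"
    and Theta_nonempty: "\<Theta> \<noteq> {}"
    and phi_range: "\<phi> \<in> M0 \<rightarrow> \<Theta>"
    and phi_iff: "\<And>\<mu> \<theta>. \<mu> \<in> M0 \<Longrightarrow> \<theta> \<in> \<Theta> \<Longrightarrow> \<phi> \<mu> = \<theta> \<longleftrightarrow> \<mu> \<in> B_set lam \<Theta> \<theta>"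
    and phi_cont: "continuous_on M0 \<phi>"
begin

lemma Theta_subset: "\<Theta> \<subseteq> \<Theta>0"
  using Theta_closed closedin_subset by force

lemma mem_B_set_iff: "t \<in> B_set lam \<Theta> \<theta> \<longleftrightarrow> t \<in> M0 \<and> t - mean \<theta> \<in> normal_cone \<Theta> \<theta>"
  by (force simp: B_set_def image_iff algebra_simps)

lemma B_set_eq: "\<theta> \<in> \<Theta> \<Longrightarrow> B_set lam \<Theta> \<theta> = {t \<in> M0. \<phi> t = \<theta>}"
  using phi_iff mem_B_set_iff by blast

lemma mean_mem_B_set: "\<theta> \<in> \<Theta> \<Longrightarrow> mean \<theta> \<in> B_set lam \<Theta> \<theta>"
  using Theta_subset by (auto simp: mem_B_set_iff zero_mem_normal_cone mean_mem)

lemma phi_eq_minimizer: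
  assumes t: "t \<in> M0" and \<theta>: "\<theta> \<in> \<Theta>"
    and min: "\<And>\<theta>'. \<theta>' \<in> \<Theta> \<Longrightarrow> \<kappa> \<theta> - \<theta> \<bullet> t \<le> \<kappa> \<theta>' - \<theta>' \<bullet> t"
  shows "\<phi> t = \<theta>"
proof -
  have "- (mean \<theta> - t) \<in> normal_cone \<Theta> \<theta>"
    using \<theta> Theta_subset by (intro first_order_condition[OF _ GDERIV_dual] min) auto
  then show ?thesis using t \<theta> phi_iff by (simp add: mem_B_set_iff)
qed

text \<open>  Up to a constant, \<open>D(natural t || \<theta>)\<close> is \<open>\<kappa> \<theta> - \<theta> \<bullet> t\<close>. A minimiser over \<open>\<Theta>\<close> exists, and each
  minimiser is \<open>\<phi> t\<close> by the first-order condition.\<close>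

lemma m_projection_iff_phi:
  assumes t: "t \<in> M0"
  shows "m_projection lam \<Theta> (natural t) \<theta> \<longleftrightarrow> \<theta> = \<phi> t"
proof -
  have "KL_div lam (natural t) \<theta> = (natural t \<bullet> t - \<kappa> (natural t)) + (\<kappa> \<theta> - \<theta> \<bullet> t)" if "\<theta> \<in> \<Theta>" for \<theta>
    using that Theta_subset t by (subst KL_div_natural) (auto simp: llr_def inner_diff_left)
  then have iff: "m_projection lam \<Theta> (natural t) \<theta> \<longleftrightarrow>
      \<theta> \<in> \<Theta> \<and> (\<forall>\<theta>'\<in>\<Theta>. \<kappa> \<theta> - \<theta> \<bullet> t \<le> \<kappa> \<theta>' - \<theta>' \<bullet> t)" for \<theta>
    by (auto simp: m_projection_def is_arg_min_linorder)
  obtain \<theta>\<^sub>1 where "\<theta>\<^sub>1 \<in> \<Theta>" "\<And>\<theta>'. \<theta>' \<in> \<Theta> \<Longrightarrow> \<kappa> \<theta>\<^sub>1 - \<theta>\<^sub>1 \<bullet> t \<le> \<kappa> \<theta>' - \<theta>' \<bullet> t"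
    using exists_dual_minimizer[OF compact_dual_sublevel[OF t] Theta_closed Theta_nonempty] by blast
  then show ?thesis using iff phi_eq_minimizer[OF t] by blast
qed

lemma constrained_mle_phi: "constrained_mle lam \<Theta> \<phi>"
  unfolding constrained_mle_def
  using borel_measurable_continuous_on_restrict[OF phi_cont] m_projection_iff_phi by blast

lemma constrained_mle_unique:
  "constrained_mle lam \<Theta> \<psi> \<Longrightarrow> t \<in> M0 \<Longrightarrow> \<psi> t = \<phi> t"
  unfolding constrained_mle_def using m_projection_iff_phi by blast

lemma T_set_eq:
  assumes "\<theta> \<in> \<Theta>"
  shows "T_set lam \<phi> \<theta> = natural ` B_set lam \<Theta> \<theta>"
  unfolding B_set_eq[OF assms] T_set_def
proof (intro equalityI subsetI)
  fix \<theta>' assume "\<theta>' \<in> {\<theta>' \<in> \<Theta>0. \<phi> (mean \<theta>') = \<theta>}"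
  then show "\<theta>' \<in> natural ` {t \<in> M0. \<phi> t = \<theta>}"
    by (intro image_eqI[of _ _ "mean \<theta>'"]) (auto simp: grad_conj_mean mean_mem)
qed (auto simp: natural_mem mean_natural)

text \<open>  The affine minorant \<open>llr \<theta>\<^sub>0 \<theta>\<close> of the rate touches it at \<open>mean \<theta>\<close> and has slope \<open>\<theta> - \<theta>\<^sub>0\<close>, which is
  nonnegative on normal vectors when \<open>\<theta>\<^sub>0 - \<theta>\<close> is in the admissible cone.\<close>

lemma rate_minimal_at_mean:
  assumes \<theta>: "\<theta> \<in> \<Theta>" and cone: "\<theta>\<^sub>0 - \<theta> \<in> admissible_cone \<Theta> \<theta>" and t: "t \<in> B_set lam \<Theta> \<theta>"
  shows "llr \<theta>\<^sub>0 \<theta> (mean \<theta>) \<le> llr \<theta>\<^sub>0 (natural t) t"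
proof -
  have tM: "t \<in> M0" and "t - mean \<theta> \<in> normal_cone \<Theta> \<theta>" using t by (auto simp: mem_B_set_iff)
  then have "(\<theta>\<^sub>0 - \<theta>) \<bullet> (t - mean \<theta>) \<le> 0" using cone by (simp add: normal_cone_def)
  then have "llr \<theta>\<^sub>0 \<theta> (mean \<theta>) \<le> llr \<theta>\<^sub>0 \<theta> t" by (simp add: llr_def algebra_simps)
  also have "\<dots> \<le> llr \<theta>\<^sub>0 (natural t) t"
    using \<theta> Theta_subset tM by (intro llr_le_llr_natural) auto
  finally show ?thesis .
qed

text \<open>  Choose a normal vector \<open>v\<close> with \<open>(\<theta>\<^sub>0 - \<theta>) \<bullet> v > 0\<close> and move from \<open>mean \<theta>\<close> to \<open>mean \<theta> + e v\<close>. Convexity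
  bounds the change of the rate by \<open>e * ((natural (mean \<theta> + e v) - \<theta>\<^sub>0) \<bullet> v)\<close>, and by continuity of
  \<open>natural\<close> this is negative for small \<open>e > 0\<close>.\<close>

lemma rate_smaller_off_cone:
  assumes \<theta>: "\<theta> \<in> \<Theta>" and cone: "\<theta>\<^sub>0 - \<theta> \<notin> admissible_cone \<Theta> \<theta>"
  obtains t where "t \<in> B_set lam \<Theta> \<theta>" "llr \<theta>\<^sub>0 (natural t) t < llr \<theta>\<^sub>0 \<theta> (mean \<theta>)"
proof -
  have \<theta>0: "\<theta> \<in> \<Theta>0" using \<theta> Theta_subset by auto
  obtain v where v: "v \<in> normal_cone \<Theta> \<theta>" "0 < (\<theta>\<^sub>0 - \<theta>) \<bullet> v"
    using exists_normal_separating[OF cone] .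
  define p where "p e = mean \<theta> + e *\<^sub>R v" for e :: real
  have "((\<lambda>e. mean \<theta> + e *\<^sub>R v) \<longlongrightarrow> mean \<theta> + 0 *\<^sub>R v) (at_right 0)"
    by (intro tendsto_intros)
  then have p_lim: "(p \<longlongrightarrow> mean \<theta>) (at_right 0)" by (simp add: p_def[abs_def])
  have ev_M0: "\<forall>\<^sub>F e in at_right 0. p e \<in> M0"
    using topological_tendstoD[OF p_lim open_mean_domain mean_mem[OF \<theta>0]] .
  have "isCont natural (mean \<theta>)"
    using continuous_on_grad_conj open_mean_domain mean_mem[OF \<theta>0]
    by (simp add: continuous_on_eq_continuous_at)
  from isCont_tendsto_compose[OF this p_lim]
  have "((\<lambda>e. (natural (p e) - \<theta>\<^sub>0) \<bullet> v) \<longlongrightarrow> (\<theta> - \<theta>\<^sub>0) \<bullet> v) (at_right 0)"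
    by (intro tendsto_intros) (simp add: grad_conj_mean[OF \<theta>0])
  then have "\<forall>\<^sub>F e in at_right 0. (natural (p e) - \<theta>\<^sub>0) \<bullet> v < 0"
    by (rule order_tendstoD) (use v(2) in \<open>simp add: inner_diff_left\<close>)
  then have "\<forall>\<^sub>F e in at_right 0. p e \<in> M0 \<and> (natural (p e) - \<theta>\<^sub>0) \<bullet> v < 0 \<and> 0 < e"
    using ev_M0 eventually_at_right_less[of 0] by eventually_elim simp
  then obtain e where e: "p e \<in> M0" "(natural (p e) - \<theta>\<^sub>0) \<bullet> v < 0" "0 < e"
    using eventually_happens[of _ "at_right (0::real)"] by auto
  show ?thesis
  proof (rule that)
    have "\<And>w. w \<in> admissible_cone \<Theta> \<theta> \<Longrightarrow> w \<bullet> (e *\<^sub>R v) \<le> 0"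
      using v(1) e(3) by (simp add: normal_cone_def mult_nonneg_nonpos)
    then show "p e \<in> B_set lam \<Theta> \<theta>" using e(1) by (simp add: mem_B_set_iff p_def normal_cone_def)
    have "llr \<theta>\<^sub>0 (natural (p e)) (mean \<theta>) \<le> llr \<theta>\<^sub>0 \<theta> (mean \<theta>)"
      using llr_le_llr_natural[OF mean_mem[OF \<theta>0] natural_mem[OF e(1)]] by (simp add: grad_conj_mean[OF \<theta>0])
    moreover have "llr \<theta>\<^sub>0 (natural (p e)) (p e) =
        llr \<theta>\<^sub>0 (natural (p e)) (mean \<theta>) + e * ((natural (p e) - \<theta>\<^sub>0) \<bullet> v)"
      by (simp add: llr_def p_def inner_add_right)
    ultimately show "llr \<theta>\<^sub>0 (natural (p e)) (p e) < llr \<theta>\<^sub>0 \<theta> (mean \<theta>)"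
      using e(2,3) mult_pos_neg[of e] by fastforce
  qed
qed

lemma KL_div_minimal_iff:
  assumes \<theta>: "\<theta> \<in> \<Theta>" and \<theta>\<^sub>0: "\<theta>\<^sub>0 \<in> \<Theta>0"
  shows "(\<forall>\<theta>'\<in>T_set lam \<phi> \<theta>. KL_div lam \<theta> \<theta>\<^sub>0 \<le> KL_div lam \<theta>' \<theta>\<^sub>0) \<longleftrightarrow>
    \<theta>\<^sub>0 - \<theta> \<in> admissible_cone \<Theta> \<theta>"
proof -
  have KL: "KL_div lam \<theta> \<theta>\<^sub>0 = llr \<theta>\<^sub>0 \<theta> (mean \<theta>)"
    using \<theta> Theta_subset \<theta>\<^sub>0 by (intro KL_div_eq) auto
  have KLt: "KL_div lam (natural t) \<theta>\<^sub>0 = llr \<theta>\<^sub>0 (natural t) t" if "t \<in> B_set lam \<Theta> \<theta>" for t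
    using that \<theta>\<^sub>0 by (intro KL_div_natural) (auto simp: mem_B_set_iff)
  show ?thesis
    unfolding T_set_eq[OF \<theta>] KL
  proof
    assume minimal: "\<forall>\<theta>'\<in>natural ` B_set lam \<Theta> \<theta>. llr \<theta>\<^sub>0 \<theta> (mean \<theta>) \<le> KL_div lam \<theta>' \<theta>\<^sub>0"
    show "\<theta>\<^sub>0 - \<theta> \<in> admissible_cone \<Theta> \<theta>"
    proof (rule ccontr)
      assume "\<theta>\<^sub>0 - \<theta> \<notin> admissible_cone \<Theta> \<theta>"
      then obtain t where t: "t \<in> B_set lam \<Theta> \<theta>" "llr \<theta>\<^sub>0 (natural t) t < llr \<theta>\<^sub>0 \<theta> (mean \<theta>)"
        by (rule rate_smaller_off_cone[OF \<theta>])
      then show False using bspec[OF minimal imageI[OF t(1)]] by (simp add: KLt)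
    qed
  next
    assume "\<theta>\<^sub>0 - \<theta> \<in> admissible_cone \<Theta> \<theta>"
    then show "\<forall>\<theta>'\<in>natural ` B_set lam \<Theta> \<theta>. llr \<theta>\<^sub>0 \<theta> (mean \<theta>) \<le> KL_div lam \<theta>' \<theta>\<^sub>0"
      using rate_minimal_at_mean[OF \<theta>] by (auto simp: KLt)
  qed
qed

end

section \<open>Exponential rates and half-space covers\<close>

lemma ln_ennreal_mono: "x \<le> y \<Longrightarrow> ln_ennreal x \<le> ln_ennreal y"
  unfolding ln_ennreal_def
  by (auto simp: top_unique enn2real_mono less_top enn2real_positive_iff zero_less_iff_neq_zero)

lemma ln_ennreal_ennreal: "0 < r \<Longrightarrow> ln_ennreal (ennreal r) = ereal (ln r)"
  by (simp add: ln_ennreal_def)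

text \<open>  The prefactor \<open>c\<close> disappears on the exponential scale.\<close>

lemma log_rate_tendsto:
  assumes "0 < c"
  shows "(\<lambda>n. ereal (1 / real n) * ln_ennreal (ennreal (c * exp (- (real n * b))))) \<longlonglongrightarrow> ereal (- b)"
proof -
  have "(\<lambda>n. ln c / real n - b) \<longlonglongrightarrow> 0 - b"
    by (intro tendsto_intros lim_const_over_n)
  then have lim: "(\<lambda>n. ereal (ln c / real n - b)) \<longlonglongrightarrow> ereal (- b)" by simp
  have "\<forall>\<^sub>F n in sequentially. ereal (ln c / real n - b) =
      ereal (1 / real n) * ln_ennreal (ennreal (c * exp (- (real n * b))))"
    using eventually_gt_at_top[of 0]
  proof eventually_elim
    case (elim n)
    have "ln_ennreal (ennreal (c * exp (- (real n * b)))) = ereal (ln c - real n * b)"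
      using assms by (simp add: ln_ennreal_ennreal ln_mult)
    then show ?case using elim by (simp add: field_simps)
  qed
  from Lim_transform_eventually[OF lim this] show ?thesis .
qed

lemma liminf_log_rate_ge:
  assumes "0 < c" and le: "\<forall>\<^sub>F n in sequentially. ennreal (c * exp (- (real n * b))) \<le> p n"
  shows "ereal (- b) \<le> liminf (\<lambda>n. ereal (1 / real n) * ln_ennreal (p n))"
proof -
  have "ereal (- b) = liminf (\<lambda>n. ereal (1 / real n) * ln_ennreal (ennreal (c * exp (- (real n * b)))))"
    using log_rate_tendsto[OF assms(1), of b] by (intro lim_imp_Liminf[symmetric]) auto
  also have "\<dots> \<le> liminf (\<lambda>n. ereal (1 / real n) * ln_ennreal (p n))"
    by (rule Liminf_mono) (use le in eventually_elim, intro ereal_mult_left_mono ln_ennreal_mono, auto)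
  finally show ?thesis .
qed

lemma limsup_log_rate_le:
  assumes "0 < c" and le: "\<forall>\<^sub>F n in sequentially. p n \<le> ennreal (c * exp (- (real n * b)))"
  shows "limsup (\<lambda>n. ereal (1 / real n) * ln_ennreal (p n)) \<le> ereal (- b)"
proof -
  have "limsup (\<lambda>n. ereal (1 / real n) * ln_ennreal (p n)) \<le>
      limsup (\<lambda>n. ereal (1 / real n) * ln_ennreal (ennreal (c * exp (- (real n * b)))))"
    by (rule Limsup_mono) (use le in eventually_elim, intro ereal_mult_left_mono ln_ennreal_mono, auto)
  also have "\<dots> = ereal (- b)"
    using log_rate_tendsto[OF assms(1), of b] by (intro lim_imp_Limsup) auto
  finally show ?thesis .
qed

context full_exponential_family
begin

lemma continuous_on_llr [continuous_intros]: "continuous_on A (llr \<theta> \<theta>')"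
  unfolding llr_def by (intro continuous_intros)

lemma open_llr_halfspace: "open {s. b < llr \<theta> \<theta>' s}"
  by (intro open_Collect_less continuous_on_const continuous_on_llr)

lemma borel_measurable_llr [measurable]: "llr \<theta> \<theta>' \<in> borel_measurable borel"
  by (intro borel_measurable_continuous_onI continuous_on_llr)

text \<open>  The slopes \<open>\<plusminus>r b\<close>, with \<open>b\<close> in the basis, already suffice: one of them exceeds a fixed multiple of
  the norm at \<open>s\<close>. This gives both exponential tightness and boundedness of sublevel sets.\<close>

lemma llr_large_far_away:
  assumes "\<theta> \<in> \<Theta>0"
  obtains T R where "finite T" "T \<subseteq> \<Theta>0" "\<And>s. R < norm s \<Longrightarrow> \<exists>\<theta>'\<in>T. a < llr \<theta> \<theta>' s"
proof -
  obtain r where r: "0 < r" "cball \<theta> r \<subseteq> \<Theta>0"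
    using open_domain assms open_contains_cball by blast
  define T where "T = (\<Union>b\<in>Basis. {\<theta> + r *\<^sub>R b, \<theta> - r *\<^sub>R b})"
  define L where "L = (\<Sum>\<theta>'\<in>T. \<bar>\<kappa> \<theta>' - \<kappa> \<theta>\<bar>)"
  define R where "R = real DIM('a) * ((\<bar>a\<bar> + L) / r)"
  have fin: "finite T" by (simp add: T_def)
  have "T \<subseteq> \<Theta>0" using r by (auto simp: T_def subset_eq dist_norm)
  moreover have "\<exists>\<theta>'\<in>T. a < llr \<theta> \<theta>' s" if s: "R < norm s" for s
  proof -
    obtain b where b: "b \<in> Basis" "norm s \<le> real DIM('a) * \<bar>s \<bullet> b\<bar>"
      using exists_basis_norm_le by blast
    have "real DIM('a) * ((\<bar>a\<bar> + L) / r) < real DIM('a) * \<bar>s \<bullet> b\<bar>"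
      using s b(2) by (simp add: R_def)
    then have big: "\<bar>a\<bar> + L < r * \<bar>s \<bullet> b\<bar>"
      using r(1) by (simp add: divide_less_eq mult.commute)
    define \<theta>' where "\<theta>' = (if 0 \<le> s \<bullet> b then \<theta> + r *\<^sub>R b else \<theta> - r *\<^sub>R b)"
    have T: "\<theta>' \<in> T" using b(1) by (auto simp: \<theta>'_def T_def)
    have "\<bar>\<kappa> \<theta>' - \<kappa> \<theta>\<bar> \<le> L"
      unfolding L_def by (rule member_le_sum[OF T _ fin, of "\<lambda>\<theta>'. \<bar>\<kappa> \<theta>' - \<kappa> \<theta>\<bar>"]) simp
    moreover have "(\<theta>' - \<theta>) \<bullet> s = r * \<bar>s \<bullet> b\<bar>"
      by (simp add: \<theta>'_def inner_commute)
    ultimately have "a < llr \<theta> \<theta>' s" using big by (simp add: llr_def)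
    then show ?thesis using T by blast
  qed
  ultimately show ?thesis by (rule that[OF fin])
qed

text \<open>  Far away finitely many half-spaces suffice, and the remaining part of \<open>C\<close> is compact. The levels
  are strengthened uniformly from \<open>a\<close> to some \<open>b > a\<close>; for \<open>a = 0\<close> this is what makes the
  bounds of the weak law tend to \<open>0\<close>.\<close>

lemma finite_halfspace_cover:
  assumes \<theta>: "\<theta> \<in> \<Theta>0" and C: "closed C" and cover: "\<And>s. s \<in> C \<Longrightarrow> \<exists>\<theta>'\<in>\<Theta>0. a < llr \<theta> \<theta>' s"
  obtains T b where "finite T" "T \<subseteq> \<Theta>0" "a < b" "\<And>s. s \<in> C \<Longrightarrow> \<exists>\<theta>'\<in>T. b < llr \<theta> \<theta>' s"
proof -
  obtain T1 R where T1: "finite T1" "T1 \<subseteq> \<Theta>0" "\<And>s. R < norm s \<Longrightarrow> \<exists>\<theta>'\<in>T1. a + 1 < llr \<theta> \<theta>' s"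
    using llr_large_far_away[OF \<theta>] by blast
  \<comment> \<open>Each half-space carries its own level above \<open>a\<close>; finitely many levels have a minimum above \<open>a\<close>.\<close>
  let ?P = "\<Theta>0 \<times> {a<..}" and ?H = "\<lambda>p. {s. snd p < llr \<theta> (fst p) s}"
  have "compact (C \<inter> cball 0 R)" using C by (intro closed_Int_compact) auto
  moreover have "open (?H p)" for p by (rule open_llr_halfspace)
  moreover have "C \<inter> cball 0 R \<subseteq> (\<Union>p\<in>?P. ?H p)"
  proof
    fix s assume "s \<in> C \<inter> cball 0 R"
    then obtain \<theta>' where "\<theta>' \<in> \<Theta>0" "a < llr \<theta> \<theta>' s" using cover by blast
    moreover from this(2) obtain b where "a < b" "b < llr \<theta> \<theta>' s" using dense by blast
    ultimately show "s \<in> (\<Union>p\<in>?P. ?H p)" by (intro UN_I[of "(\<theta>', b)"]) auto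
  qed
  ultimately obtain P where P: "P \<subseteq> ?P" "finite P" "C \<inter> cball 0 R \<subseteq> (\<Union>p\<in>P. ?H p)"
    by (rule compactE_image)
  define b where "b = Min (insert (a + 1) (snd ` P))"
  show ?thesis
  proof (rule that[of "T1 \<union> fst ` P" b])
    show "finite (T1 \<union> fst ` P)" "T1 \<union> fst ` P \<subseteq> \<Theta>0" using T1 P by auto
    show "a < b" unfolding b_def using P(1,2) by (subst Min_gr_iff) auto
    have b_le: "b \<le> a + 1" "\<And>p. p \<in> P \<Longrightarrow> b \<le> snd p" unfolding b_def using P(2) by auto
    fix s assume s: "s \<in> C"
    show "\<exists>\<theta>'\<in>T1 \<union> fst ` P. b < llr \<theta> \<theta>' s"
    proof (cases "R < norm s")
      case True
      then show ?thesis using T1(3)[OF True] b_le(1) by force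
    next
      case False
      then obtain p where "p \<in> P" "snd p < llr \<theta> (fst p) s" using P(3) s by fastforce
      then show ?thesis using b_le(2)[of p] by force
    qed
  qed
qed

text \<open>  If no parameter improved on \<open>\<theta>\<close> at \<open>s\<close>, then \<open>\<theta>\<close> would be the maximum likelihood estimate and \<open>s\<close>
  its mean.\<close>

lemma exists_llr_pos:
  assumes "\<theta> \<in> \<Theta>0" "s \<noteq> mean \<theta>"
  shows "\<exists>\<theta>'\<in>\<Theta>0. 0 < llr \<theta> \<theta>' s"
proof (rule ccontr)
  assume "\<not> ?thesis"
  then have "\<kappa> \<theta> - \<theta> \<bullet> s \<le> \<kappa> \<theta>' - \<theta>' \<bullet> s" if "\<theta>' \<in> \<Theta>0" for \<theta>'
    using that by (force simp: llr_def inner_diff_left not_less)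
  from mean_eq_of_dual_minimizer[OF assms(1) this] assms(2) show False by simp
qed

lemma nn_integral_exp_fam_llr:
  assumes "\<theta> \<in> \<Theta>0"
  shows "(\<integral>\<^sup>+ x. ennreal (exp (llr \<theta>\<^sub>0 \<theta> x)) \<partial>exp_fam lam \<theta>\<^sub>0) = 1"
proof -
  have "(\<integral>\<^sup>+ x. ennreal (exp (llr \<theta>\<^sub>0 \<theta> x)) \<partial>exp_fam lam \<theta>\<^sub>0) =
      (\<integral>\<^sup>+ x. ennreal (exp (- \<kappa> \<theta>)) * ennreal (exp (\<theta> \<bullet> (x - 0))) \<partial>lam)"
    unfolding exp_fam_def
    by (subst nn_integral_density)
      (auto intro!: nn_integral_cong simp: llr_def inner_diff_left simp flip: ennreal_mult exp_add)
  also have "\<dots> = ennreal (exp (- \<kappa> \<theta>)) * ennreal (exp (\<kappa> \<theta>))"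
    using nn_integral_exp_shift[OF assms, of 0] by (simp add: nn_integral_cmult)
  also have "\<dots> = 1" by (simp flip: ennreal_mult exp_add)
  finally show ?thesis .
qed

end

section \<open>Large deviations of the sample mean\<close>

locale exponential_family_sampling = full_exponential_family lam + prob_space \<Omega>
  for lam :: "'a::euclidean_space measure" and \<Omega> :: "'b measure" +
  fixes X :: "nat \<Rightarrow> 'b \<Rightarrow> 'a" and \<theta>\<^sub>0 :: 'a
  assumes theta0: "\<theta>\<^sub>0 \<in> \<Theta>0"
    and X_indep: "indep_vars (\<lambda>_. borel) X UNIV"
    and X_law: "\<And>i. distr \<Omega> borel (X i) = exp_fam lam \<theta>\<^sub>0"
    and mean_in: "\<And>n. n \<ge> 1 \<Longrightarrow> AE \<omega> in \<Omega>. sample_mean X n \<omega> \<in> M0"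
begin

lemma X_measurable [measurable]: "X i \<in> borel_measurable \<Omega>"
  using X_indep unfolding indep_vars_def by auto

lemma sample_mean_measurable [measurable]: "sample_mean X n \<in> borel_measurable \<Omega>"
  unfolding sample_mean_def by measurable

lemma sample_mean_event:
  "C \<in> sets borel \<Longrightarrow> {\<omega> \<in> space \<Omega>. sample_mean X n \<omega> \<in> C} \<in> sets \<Omega>"
  using measurable_sets[OF sample_mean_measurable, of C n] by (simp add: vimage_def Int_def conj_commute)

text \<open>  Samples of size one lie in \<open>M0\<close>, and all members of the family have the same null sets as \<open>lam\<close>.\<close>

lemma AE_lam_mean_domain: "AE x in lam. x \<in> M0"
proof -
  have "M0 \<in> sets borel" using open_mean_domain by simp
  have "AE \<omega> in \<Omega>. X 0 \<omega> \<in> M0"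
    using mean_in[of 1] by (simp add: sample_mean_def)
  then have "AE x in distr \<Omega> borel (X 0). x \<in> M0"
    using \<open>M0 \<in> sets borel\<close> by (subst AE_distr_iff) auto
  then show ?thesis
    unfolding X_law exp_fam_def by (subst (asm) AE_density) auto
qed

abbreviation "rate t \<equiv> llr \<theta>\<^sub>0 (natural t) t"

text \<open>  The law under which the first \<open>n\<close> observations are independent with common law \<open>P\<^bsub>\<theta>\<^esub>\<close>, realised
  as a change of measure on \<open>\<Omega>\<close>.\<close>

definition "tilted \<theta> n = density \<Omega> (\<lambda>\<omega>. ennreal (exp (real n * llr \<theta>\<^sub>0 \<theta> (sample_mean X n \<omega>))))"

lemma sets_tilted [measurable_cong, simp]: "sets (tilted \<theta> n) = sets \<Omega>"
  and space_tilted [simp]: "space (tilted \<theta> n) = space \<Omega>"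
  by (simp_all add: tilted_def)

lemma tilted_theta0: "tilted \<theta>\<^sub>0 n = \<Omega>"
  by (simp add: tilted_def density_1)

lemma emeasure_tilted:
  assumes [measurable]: "A \<in> sets \<Omega>"
  shows "emeasure (tilted \<theta> n) A =
    (\<integral>\<^sup>+ \<omega>. ennreal (exp (real n * llr \<theta>\<^sub>0 \<theta> (sample_mean X n \<omega>))) * indicator A \<omega> \<partial>\<Omega>)"
  unfolding tilted_def by (rule emeasure_density) auto

lemma likelihood_ratio_integral:
  assumes \<theta>: "\<theta> \<in> \<Theta>0" and n: "n \<ge> 1"
  shows "(\<integral>\<^sup>+ \<omega>. ennreal (exp (real n * llr \<theta>\<^sub>0 \<theta> (sample_mean X n \<omega>))) \<partial>\<Omega>) = 1"
proof -
  let ?Y = "\<lambda>i \<omega>. ennreal (exp (llr \<theta>\<^sub>0 \<theta> (X i \<omega>)))"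
  have "ennreal (exp (real n * llr \<theta>\<^sub>0 \<theta> (sample_mean X n \<omega>))) = (\<Prod>i<n. ?Y i \<omega>)" for \<omega>
  proof -
    have "real n * llr \<theta>\<^sub>0 \<theta> (sample_mean X n \<omega>) = (\<Sum>i<n. llr \<theta>\<^sub>0 \<theta> (X i \<omega>))"
      using n by (simp add: llr_def sample_mean_def sum_subtractf inner_sum_right right_diff_distrib)
    then show ?thesis by (simp add: exp_sum prod_ennreal)
  qed
  then have "(\<integral>\<^sup>+ \<omega>. ennreal (exp (real n * llr \<theta>\<^sub>0 \<theta> (sample_mean X n \<omega>))) \<partial>\<Omega>) =
      (\<integral>\<^sup>+ \<omega>. (\<Prod>i<n. ?Y i \<omega>) \<partial>\<Omega>)"
    by simp
  also have "\<dots> = (\<Prod>i<n. \<integral>\<^sup>+ \<omega>. ?Y i \<omega> \<partial>\<Omega>)"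
  proof (rule indep_vars_nn_integral)
    have "indep_vars (\<lambda>_. borel) X {..<n}"
      by (rule indep_vars_subset[OF X_indep]) auto
    then show "indep_vars (\<lambda>_. borel) ?Y {..<n}"
      by (rule indep_vars_compose2) measurable
  qed auto
  also have "\<dots> = (\<Prod>i<n. 1)"
  proof (rule prod.cong)
    fix i
    have "(\<integral>\<^sup>+ \<omega>. ?Y i \<omega> \<partial>\<Omega>) = (\<integral>\<^sup>+ x. ennreal (exp (llr \<theta>\<^sub>0 \<theta> x)) \<partial>distr \<Omega> borel (X i))"
      by (rule nn_integral_distr[symmetric]) measurable
    then show "(\<integral>\<^sup>+ \<omega>. ?Y i \<omega> \<partial>\<Omega>) = 1" by (simp add: X_law nn_integral_exp_fam_llr \<theta>)
  qed simp
  finally show ?thesis by simp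
qed

lemma prob_space_tilted:
  assumes "\<theta> \<in> \<Theta>0" "n \<ge> 1"
  shows "prob_space (tilted \<theta> n)"
proof (rule prob_spaceI)
  have "emeasure (tilted \<theta> n) (space \<Omega>) =
      (\<integral>\<^sup>+ \<omega>. ennreal (exp (real n * llr \<theta>\<^sub>0 \<theta> (sample_mean X n \<omega>))) \<partial>\<Omega>)"
    by (subst emeasure_tilted) (auto intro!: nn_integral_cong)
  then show "emeasure (tilted \<theta> n) (space (tilted \<theta> n)) = 1"
    using likelihood_ratio_integral[OF assms] by simp
qed

text \<open>  Markov's inequality for the likelihood ratio of \<open>\<theta>'\<close> against \<open>\<theta>\<close>, whose integral under the law
  tilted to \<open>\<theta>\<close> is one.\<close>

lemma chernoff_halfspace:
  assumes \<theta>': "\<theta>' \<in> \<Theta>0" and n: "n \<ge> 1"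
  shows "emeasure (tilted \<theta> n) {\<omega> \<in> space \<Omega>. b < llr \<theta> \<theta>' (sample_mean X n \<omega>)} \<le>
    ennreal (exp (- (real n * b)))"
proof -
  let ?S = "sample_mean X n"
  let ?A = "{\<omega> \<in> space \<Omega>. b < llr \<theta> \<theta>' (?S \<omega>)}"
  have "emeasure (tilted \<theta> n) ?A =
      (\<integral>\<^sup>+ \<omega>. ennreal (exp (real n * llr \<theta>\<^sub>0 \<theta> (?S \<omega>))) * indicator ?A \<omega> \<partial>\<Omega>)"
    by (rule emeasure_tilted) measurable
  also have "\<dots> \<le> (\<integral>\<^sup>+ \<omega>. ennreal (exp (- (real n * b))) *
      ennreal (exp (real n * llr \<theta>\<^sub>0 \<theta>' (?S \<omega>))) \<partial>\<Omega>)"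
  proof (intro nn_integral_mono)
    fix \<omega>
    show "ennreal (exp (real n * llr \<theta>\<^sub>0 \<theta> (?S \<omega>))) * indicator ?A \<omega> \<le>
        ennreal (exp (- (real n * b))) * ennreal (exp (real n * llr \<theta>\<^sub>0 \<theta>' (?S \<omega>)))"
    proof (cases "\<omega> \<in> ?A")
      case True
      then have "real n * b \<le> real n * llr \<theta> \<theta>' (?S \<omega>)" by (intro mult_left_mono) auto
      then have "real n * llr \<theta>\<^sub>0 \<theta> (?S \<omega>) \<le> - (real n * b) + real n * llr \<theta>\<^sub>0 \<theta>' (?S \<omega>)"
        unfolding llr_chain[of \<theta>\<^sub>0 \<theta> "?S \<omega>" \<theta>', symmetric] by (simp add: distrib_left)
      then show ?thesis using True by (simp flip: ennreal_mult exp_add)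
    qed simp
  qed
  also have "\<dots> = ennreal (exp (- (real n * b)))"
    using likelihood_ratio_integral[OF \<theta>' n] by (simp add: nn_integral_cmult)
  finally show ?thesis .
qed

lemma exponential_upper_bound:
  assumes \<theta>: "\<theta> \<in> \<Theta>0" and C: "closed C"
    and cover: "\<And>s. s \<in> C \<Longrightarrow> \<exists>\<theta>'\<in>\<Theta>0. a < llr \<theta> \<theta>' s"
  obtains N b where "0 < N" "a < b"
    "\<And>n. n \<ge> 1 \<Longrightarrow>
      emeasure (tilted \<theta> n) {\<omega> \<in> space \<Omega>. sample_mean X n \<omega> \<in> C} \<le> ennreal (N * exp (- (real n * b)))"
proof -
  obtain T b where T: "finite T" "T \<subseteq> \<Theta>0" "a < b" "\<And>s. s \<in> C \<Longrightarrow> \<exists>\<theta>'\<in>T. b < llr \<theta> \<theta>' s"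
    using finite_halfspace_cover[OF \<theta> C cover] by blast
  \<comment> \<open>The summand \<open>1\<close> keeps the constant positive when the cover is empty.\<close>
  show ?thesis
  proof (rule that[of "real (card T) + 1" b])
    fix n :: nat assume n: "n \<ge> 1"
    let ?H = "\<lambda>\<theta>'. {\<omega> \<in> space \<Omega>. b < llr \<theta> \<theta>' (sample_mean X n \<omega>)}"
    have "emeasure (tilted \<theta> n) {\<omega> \<in> space \<Omega>. sample_mean X n \<omega> \<in> C} \<le>
        emeasure (tilted \<theta> n) (\<Union>\<theta>'\<in>T. ?H \<theta>')"
      using T(1,4) by (intro emeasure_mono) (auto intro!: sets.finite_UN)
    also have "\<dots> \<le> (\<Sum>\<theta>'\<in>T. emeasure (tilted \<theta> n) (?H \<theta>'))"
      using T(1) by (intro emeasure_subadditive_finite) auto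
    also have "\<dots> \<le> (\<Sum>\<theta>'\<in>T. ennreal (exp (- (real n * b))))"
      using T(2) n by (intro sum_mono chernoff_halfspace) auto
    also have "\<dots> \<le> ennreal ((real (card T) + 1) * exp (- (real n * b)))"
      by (simp add: ennreal_mult ennreal_of_nat_eq_real_of_nat mult_right_mono ennreal_leI)
    finally show "emeasure (tilted \<theta> n) {\<omega> \<in> space \<Omega>. sample_mean X n \<omega> \<in> C} \<le>
        ennreal ((real (card T) + 1) * exp (- (real n * b)))" .
  qed (use T in auto)
qed

text \<open>  The exponential upper bound at level \<open>0\<close>, applied to the complement of the ball.\<close>

lemma tilted_weak_law:
  assumes \<theta>: "\<theta> \<in> \<Theta>0" and \<rho>: "0 < \<rho>"
  shows "\<forall>\<^sub>F n in sequentially. ennreal (1 / 2) \<le>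
    emeasure (tilted \<theta> n) {\<omega> \<in> space \<Omega>. sample_mean X n \<omega> \<in> ball (mean \<theta>) \<rho>}"
proof -
  have "\<exists>\<theta>'\<in>\<Theta>0. 0 < llr \<theta> \<theta>' s" if "s \<in> - ball (mean \<theta>) \<rho>" for s
    using that \<rho> by (intro exists_llr_pos \<theta>) auto
  moreover have "closed (- ball (mean \<theta>) \<rho>)" by (intro closed_Compl open_ball)
  ultimately obtain N b where N: "0 < N" "0 < b" "\<And>n. n \<ge> 1 \<Longrightarrow>
      emeasure (tilted \<theta> n) {\<omega> \<in> space \<Omega>. sample_mean X n \<omega> \<in> - ball (mean \<theta>) \<rho>}
        \<le> ennreal (N * exp (- (real n * b)))"
    using exponential_upper_bound[OF \<theta>, of "- ball (mean \<theta>) \<rho>" 0] by blast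
  have "(\<lambda>n. N * exp (- b) ^ n) \<longlonglongrightarrow> N * 0"
    using N(2) by (intro tendsto_intros LIMSEQ_power_zero) auto
  then have "\<forall>\<^sub>F n in sequentially. N * exp (- b) ^ n < 1 / 2"
    by (intro order_tendstoD) auto
  then show ?thesis using eventually_ge_at_top[of 1]
  proof eventually_elim
    case (elim n)
    interpret Q: prob_space "tilted \<theta> n" using \<theta> elim by (intro prob_space_tilted)
    let ?B = "{\<omega> \<in> space \<Omega>. sample_mean X n \<omega> \<in> ball (mean \<theta>) \<rho>}"
    have B: "?B \<in> sets \<Omega>" by (rule sample_mean_event) simp
    have "Q.prob (space (tilted \<theta> n) - ?B) = 1 - Q.prob ?B"
      by (rule Q.prob_compl) (use B in simp)
    moreover have "space (tilted \<theta> n) - ?B = {\<omega> \<in> space \<Omega>. sample_mean X n \<omega> \<in> - ball (mean \<theta>) \<rho>}"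
      by auto
    ultimately have "ennreal (1 - Q.prob ?B) =
        emeasure (tilted \<theta> n) {\<omega> \<in> space \<Omega>. sample_mean X n \<omega> \<in> - ball (mean \<theta>) \<rho>}"
      by (metis Q.emeasure_eq_measure)
    also have "\<dots> \<le> ennreal (N * exp (- (real n * b)))"
      by (rule N(3)[OF elim(2)])
    also have "N * exp (- (real n * b)) = N * exp (- b) ^ n"
      by (simp flip: exp_of_nat_mult)
    finally have "ennreal (1 - Q.prob ?B) \<le> ennreal (N * exp (- b) ^ n)" .
    then have "1 - Q.prob ?B \<le> N * exp (- b) ^ n"
      by (rule ennreal_le_iff[THEN iffD1, rotated]) (use N(1) in simp)
    then have "1 / 2 \<le> Q.prob ?B" using elim(1) by linarith
    then show ?case unfolding Q.emeasure_eq_measure by (rule ennreal_leI)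
  qed
qed

text \<open>  Under the law tilted to \<open>natural t\<close> the sample mean concentrates at \<open>t\<close>, and on a small ball
  around \<open>t\<close> the density of that law is at most \<open>exp (n * (rate t + e))\<close>.\<close>

lemma sample_mean_lower_bound:
  assumes G: "open G" and t: "t \<in> G" "t \<in> M0"
  shows "ereal (- rate t) \<le>
    liminf (\<lambda>n. ereal (1 / real n) * ln_ennreal (emeasure \<Omega> {\<omega> \<in> space \<Omega>. sample_mean X n \<omega> \<in> G}))"
    (is "_ \<le> ?L")
proof -
  define \<theta> where "\<theta> = natural t"
  have \<theta>: "\<theta> \<in> \<Theta>0" "mean \<theta> = t" using t by (simp_all add: \<theta>_def natural_mem mean_natural)
  have "ereal (- (rate t + e)) \<le> ?L" if e: "0 < e" for e
  proof -
    obtain r where r: "0 < r" "ball t r \<subseteq> G" using G t open_contains_ball by blast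
    \<comment> \<open>small enough for \<open>llr \<theta>\<^sub>0 \<theta>\<close> to vary by at most \<open>e\<close> on the ball; the summand \<open>1\<close> covers \<open>\<theta> = \<theta>\<^sub>0\<close>\<close>
    define \<rho> where "\<rho> = min r (e / (norm (\<theta> - \<theta>\<^sub>0) + 1))"
    have pos: "0 < norm (\<theta> - \<theta>\<^sub>0) + 1" by (simp add: add_nonneg_pos)
    have \<rho>: "0 < \<rho>" "\<rho> \<le> r" using r e pos by (auto simp: \<rho>_def)
    have "norm (\<theta> - \<theta>\<^sub>0) * \<rho> \<le> norm (\<theta> - \<theta>\<^sub>0) * (e / (norm (\<theta> - \<theta>\<^sub>0) + 1))"
      by (intro mult_left_mono) (auto simp: \<rho>_def)
    also have "\<dots> \<le> e" using e pos by (simp add: field_simps)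
    finally have \<rho>_small: "norm (\<theta> - \<theta>\<^sub>0) * \<rho> \<le> e" .
    have llr_le: "llr \<theta>\<^sub>0 \<theta> s \<le> rate t + e" if "s \<in> ball t \<rho>" for s
    proof -
      have "(\<theta> - \<theta>\<^sub>0) \<bullet> (s - t) \<le> norm (\<theta> - \<theta>\<^sub>0) * norm (s - t)" by (rule norm_cauchy_schwarz)
      also have "\<dots> \<le> norm (\<theta> - \<theta>\<^sub>0) * \<rho>"
        using that by (intro mult_left_mono) (auto simp: dist_norm norm_minus_commute)
      finally show ?thesis using \<rho>_small by (simp add: llr_def \<theta>_def inner_diff_right)
    qed
    have "\<forall>\<^sub>F n in sequentially. ennreal (1/2 * exp (- (real n * (rate t + e)))) \<le>
        emeasure \<Omega> {\<omega> \<in> space \<Omega>. sample_mean X n \<omega> \<in> G}"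
      using tilted_weak_law[OF \<theta>(1) \<rho>(1)]
    proof eventually_elim
      case (elim n)
      let ?B = "{\<omega> \<in> space \<Omega>. sample_mean X n \<omega> \<in> ball t \<rho>}"
      let ?c = "exp (real n * (rate t + e))"
      have [measurable]: "?B \<in> sets \<Omega>" by (rule sample_mean_event) simp
      have "ennreal (1 / 2) \<le> emeasure (tilted \<theta> n) ?B" using elim by (simp add: \<theta>(2))
      also have "\<dots> = (\<integral>\<^sup>+ \<omega>. ennreal (exp (real n * llr \<theta>\<^sub>0 \<theta> (sample_mean X n \<omega>))) * indicator ?B \<omega> \<partial>\<Omega>)"
        by (rule emeasure_tilted) measurable
      also have "\<dots> \<le> (\<integral>\<^sup>+ \<omega>. ennreal ?c * indicator ?B \<omega> \<partial>\<Omega>)"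
        using llr_le by (intro nn_integral_mono) (auto simp: indicator_def intro!: ennreal_leI mult_left_mono)
      also have "\<dots> = ennreal ?c * emeasure \<Omega> ?B" by (rule nn_integral_cmult_indicator) measurable
      also have "\<dots> \<le> ennreal ?c * emeasure \<Omega> {\<omega> \<in> space \<Omega>. sample_mean X n \<omega> \<in> G}"
        using r \<rho> G by (intro mult_left_mono emeasure_mono sample_mean_event) auto
      also have "\<dots> = ennreal (?c * prob {\<omega> \<in> space \<Omega>. sample_mean X n \<omega> \<in> G})"
        by (simp add: emeasure_eq_measure ennreal_mult)
      finally have "1 / 2 \<le> ?c * prob {\<omega> \<in> space \<Omega>. sample_mean X n \<omega> \<in> G}"
        by (rule ennreal_le_iff[THEN iffD1, rotated]) simp
      then have "1/2 * exp (- (real n * (rate t + e))) \<le> prob {\<omega> \<in> space \<Omega>. sample_mean X n \<omega> \<in> G}"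
        unfolding exp_minus by (simp add: field_simps)
      then show ?case unfolding emeasure_eq_measure by (rule ennreal_leI)
    qed
    then show ?thesis by (intro liminf_log_rate_ge[of "1/2"]) simp
  qed
  then have "ereal (- rate t) \<le> ?L + ereal e" if "0 < e" for e
    using that by (cases ?L) (force simp: algebra_simps)+
  then show ?thesis by (rule ereal_le_epsilon2[rule_format])
qed

text \<open>  On \<open>M0\<close> the supremum of \<open>llr \<theta>\<^sub>0 \<theta>' s\<close> over \<open>\<theta>'\<close> is the rate, and elsewhere it is infinite. So the
  hypothesis restricts only points of \<open>M0\<close>.\<close>

lemma exists_llr_greater:
  assumes "\<And>t. t \<in> M0 \<Longrightarrow> t = s \<Longrightarrow> a < rate t"
  shows "\<exists>\<theta>'\<in>\<Theta>0. a < llr \<theta>\<^sub>0 \<theta>' s"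
proof (cases "s \<in> M0")
  case True
  then show ?thesis using assms[OF True refl] natural_mem by blast
next
  case False
  then show ?thesis
    using llr_unbounded_off_mean_domain[OF AE_lam_mean_domain False theta0] by metis
qed

lemma sample_mean_upper_bound:
  assumes C: "closed C" and rate: "\<And>t. t \<in> C \<Longrightarrow> t \<in> M0 \<Longrightarrow> a < rate t"
  shows "limsup (\<lambda>n. ereal (1 / real n) * ln_ennreal (emeasure \<Omega> {\<omega> \<in> space \<Omega>. sample_mean X n \<omega> \<in> C}))
    \<le> ereal (- a)"
proof -
  have "\<exists>\<theta>'\<in>\<Theta>0. a < llr \<theta>\<^sub>0 \<theta>' s" if "s \<in> C" for s
    using that rate by (intro exists_llr_greater) auto
  then obtain N b where N: "0 < N" "a < b" "\<And>n. n \<ge> 1 \<Longrightarrow>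
      emeasure \<Omega> {\<omega> \<in> space \<Omega>. sample_mean X n \<omega> \<in> C} \<le> ennreal (N * exp (- (real n * b)))"
    using exponential_upper_bound[OF theta0 C] unfolding tilted_theta0 by blast
  have "limsup (\<lambda>n. ereal (1 / real n) * ln_ennreal (emeasure \<Omega> {\<omega> \<in> space \<Omega>. sample_mean X n \<omega> \<in> C}))
      \<le> ereal (- b)"
    using N by (intro limsup_log_rate_le[of N] eventually_mono[OF eventually_ge_at_top[of 1]]) auto
  also have "\<dots> \<le> ereal (- a)" using N(2) by simp
  finally show ?thesis .
qed

text \<open>  The sublevel set is an intersection of closed half-spaces in the whole space, and not only in
  \<open>M0\<close>, because the rate is infinite off \<open>M0\<close>.\<close>

lemma compact_rate_sublevel: "compact {t \<in> M0. rate t \<le> a}"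
proof -
  have "{t \<in> M0. rate t \<le> a} = - (\<Union>\<theta>'\<in>\<Theta>0. {s. a < llr \<theta>\<^sub>0 \<theta>' s})"
  proof (intro equalityI subsetI)
    fix t assume "t \<in> {t \<in> M0. rate t \<le> a}"
    then show "t \<in> - (\<Union>\<theta>'\<in>\<Theta>0. {s. a < llr \<theta>\<^sub>0 \<theta>' s})"
      using llr_le_llr_natural[of t _ \<theta>\<^sub>0] by (force simp: not_less)
  next
    fix t assume t: "t \<in> - (\<Union>\<theta>'\<in>\<Theta>0. {s. a < llr \<theta>\<^sub>0 \<theta>' s})"
    then have "t \<in> M0" using exists_llr_greater[of t a] by auto
    then show "t \<in> {t \<in> M0. rate t \<le> a}" using t natural_mem by force
  qed
  then have closed: "closed {t \<in> M0. rate t \<le> a}"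
    using open_UN[of \<Theta>0 "\<lambda>\<theta>'. {s. a < llr \<theta>\<^sub>0 \<theta>' s}"] open_llr_halfspace
    by (metis closed_Compl)
  obtain T R where TR: "T \<subseteq> \<Theta>0" "\<And>s. R < norm s \<Longrightarrow> \<exists>\<theta>'\<in>T. a < llr \<theta>\<^sub>0 \<theta>' s"
    using llr_large_far_away[OF theta0, of a] by metis
  have "norm t \<le> R" if "t \<in> M0" "rate t \<le> a" for t
  proof (rule ccontr)
    assume "\<not> norm t \<le> R"
    then obtain \<theta>' where "\<theta>' \<in> \<Theta>0" "a < llr \<theta>\<^sub>0 \<theta>' t" using TR(1) TR(2)[of t] by auto
    then show False using llr_le_llr_natural[OF that(1), of \<theta>' \<theta>\<^sub>0] that(2) by linarith
  qed
  then have "bounded {t \<in> M0. rate t \<le> a}" by (auto simp: bounded_iff)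
  with closed show ?thesis by (simp add: compact_eq_bounded_closed)
qed

lemma rate_nonneg: "t \<in> M0 \<Longrightarrow> 0 \<le> rate t"
  using llr_le_llr_natural[of t \<theta>\<^sub>0 \<theta>\<^sub>0] theta0 by simp

end

section \<open>Large deviations of the constrained estimator\<close>

lemma space_borel_of: "space (borel_of T) = topspace T"
  unfolding borel_of_def by (rule space_measure_of) (auto dest: openin_subset)

lemma openin_in_borel_of: "openin T U \<Longrightarrow> U \<in> sets (borel_of T)"
  unfolding borel_of_def by (subst sets_measure_of) (auto dest: openin_subset)

locale constrained_sampling =
  normal_cone_partition lam \<Theta> \<phi> + exponential_family_sampling lam \<Omega> X \<theta>\<^sub>0
  for lam :: "'a::euclidean_space measure" and \<Theta> :: "'a set" and \<phi> :: "'a \<Rightarrow> 'a"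
    and \<Omega> :: "'b measure" and X :: "nat \<Rightarrow> 'b \<Rightarrow> 'a" and \<theta>\<^sub>0 :: 'a
begin

lemma continuous_on_rate: "continuous_on M0 (\<lambda>t. rate t)"
proof -
  have "continuous_on M0 (\<lambda>t. \<kappa> (natural t))"
    by (rule continuous_on_compose2[OF continuous_on_kappa continuous_on_grad_conj])
      (auto simp: natural_mem)
  then show ?thesis
    unfolding llr_def by (intro continuous_intros continuous_on_grad_conj)
qed

text \<open>  The contraction of the rate of the sample mean along \<open>\<phi>\<close>.\<close>

definition mle_rate :: "'a \<Rightarrow> ereal" where
  "mle_rate \<theta> = (INF t\<in>B_set lam \<Theta> \<theta>. ereal (rate t))"

text \<open>  Fibres of \<open>\<phi>\<close> are closed in \<open>M0\<close> and the sublevel sets of the rate are compact.\<close>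

lemma mle_rate_attained:
  assumes \<theta>: "\<theta> \<in> \<Theta>"
  obtains t where "t \<in> B_set lam \<Theta> \<theta>" "mle_rate \<theta> = ereal (rate t)"
proof -
  \<comment> \<open>\<open>mean \<theta>\<close> lies in the fibre, so points with a larger rate can be ignored.\<close>
  define L where "L = {t \<in> M0. rate t \<le> rate (mean \<theta>)}"
  define K where "K = L \<inter> \<phi> -` {\<theta>}"
  have L: "compact L" "L \<subseteq> M0" unfolding L_def by (auto intro: compact_rate_sublevel)
  have "closed K"
    unfolding K_def using L continuous_on_subset[OF phi_cont]
    by (intro continuous_closed_preimage) (auto intro: compact_imp_closed)
  then have "compact (L \<inter> K)" using L by (intro compact_Int_closed)
  then have "compact K" by (simp add: K_def Int_absorb1)
  moreover have "K \<noteq> {}"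
    using mean_mem_B_set[OF \<theta>] by (auto simp: K_def L_def B_set_eq[OF \<theta>])
  moreover have "continuous_on K (\<lambda>t. rate t)"
    using L by (intro continuous_on_subset[OF continuous_on_rate]) (auto simp: K_def)
  ultimately obtain t where t: "t \<in> K" "\<And>s. s \<in> K \<Longrightarrow> rate t \<le> rate s"
    using continuous_attains_inf[of K "\<lambda>t. rate t"] by blast
  have tB: "t \<in> B_set lam \<Theta> \<theta>"
    using t(1) by (auto simp: K_def L_def B_set_eq[OF \<theta>])
  have "rate t \<le> rate s" if "s \<in> B_set lam \<Theta> \<theta>" for s
  proof (cases "s \<in> K")
    case False
    then have "rate (mean \<theta>) < rate s"
      using that by (auto simp: K_def L_def B_set_eq[OF \<theta>])
    moreover have "rate t \<le> rate (mean \<theta>)" using t(1) by (simp add: K_def L_def)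
    ultimately show ?thesis by linarith
  qed (rule t(2))
  then have "mle_rate \<theta> = ereal (rate t)"
    unfolding mle_rate_def using tB by (intro antisym INF_lower2[of t] INF_greatest) auto
  with tB show ?thesis by (rule that)
qed

lemma mle_rate_le: "t \<in> M0 \<Longrightarrow> mle_rate (\<phi> t) \<le> ereal (rate t)"
  unfolding mle_rate_def using phi_range B_set_eq by (intro INF_lower) auto

lemma mle_rate_sublevel: "{\<theta> \<in> \<Theta>. mle_rate \<theta> \<le> ereal a} = \<phi> ` {t \<in> M0. rate t \<le> a}"
proof (intro equalityI subsetI)
  fix \<theta> assume "\<theta> \<in> {\<theta> \<in> \<Theta>. mle_rate \<theta> \<le> ereal a}"
  then have \<theta>: "\<theta> \<in> \<Theta>" "mle_rate \<theta> \<le> ereal a" by auto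
  obtain t where "t \<in> B_set lam \<Theta> \<theta>" "mle_rate \<theta> = ereal (rate t)" using mle_rate_attained[OF \<theta>(1)] .
  then show "\<theta> \<in> \<phi> ` {t \<in> M0. rate t \<le> a}"
    using \<theta> B_set_eq[OF \<theta>(1)] by (intro image_eqI[of _ _ t]) auto
next
  fix \<theta> assume "\<theta> \<in> \<phi> ` {t \<in> M0. rate t \<le> a}"
  then obtain t where t: "t \<in> M0" "rate t \<le> a" "\<theta> = \<phi> t" by auto
  then have "mle_rate \<theta> \<le> ereal a" using order_trans[OF mle_rate_le[OF t(1)]] by simp
  then show "\<theta> \<in> {\<theta> \<in> \<Theta>. mle_rate \<theta> \<le> ereal a}" using t phi_range by auto
qed

lemma good_mle_rate: "good_rate_function (top_of_set \<Theta>) mle_rate"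
proof -
  have comp: "compact {\<theta> \<in> \<Theta>. mle_rate \<theta> \<le> ereal a}" for a
    unfolding mle_rate_sublevel
    by (intro compact_continuous_image continuous_on_subset[OF phi_cont] compact_rate_sublevel) auto
  have "closedin (top_of_set \<Theta>) {\<theta> \<in> \<Theta>. mle_rate \<theta> \<le> ereal a}" for a
    using compact_imp_closed[OF comp] by (intro closed_subset) auto
  moreover have "compactin (top_of_set \<Theta>) {\<theta> \<in> \<Theta>. mle_rate \<theta> \<le> ereal a}" for a
    using comp by (auto simp: compactin_subtopology)
  moreover have "0 \<le> mle_rate \<theta>" for \<theta>
    unfolding mle_rate_def by (intro INF_greatest) (auto simp: mem_B_set_iff rate_nonneg)
  ultimately show ?thesis by (simp add: good_rate_function_def)
qed

lemma open_phi_preimage: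
  assumes "openin (top_of_set \<Theta>) U"
  shows "open {t \<in> M0. \<phi> t \<in> U}"
proof -
  have "openin (top_of_set M0) (M0 \<inter> \<phi> -` U)"
    by (rule continuous_openin_preimage[OF phi_cont phi_range assms])
  then show ?thesis
    using open_mean_domain by (simp add: openin_open_eq vimage_def Int_def)
qed

lemma closed_phi_preimage:
  assumes "closedin (top_of_set \<Theta>) C"
  obtains F where "closed F" "{t \<in> M0. \<phi> t \<in> C} = M0 \<inter> F"
proof -
  have "closedin (top_of_set M0) (M0 \<inter> \<phi> -` C)"
    by (rule continuous_closedin_preimage_gen[OF phi_cont phi_range assms])
  then show ?thesis using that by (auto simp: closedin_closed vimage_def Int_def)
qed

abbreviation "good_event n \<equiv> {\<omega> \<in> space \<Omega>. sample_mean X n \<omega> \<in> M0}"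

lemma good_event_measurable [measurable]: "good_event n \<in> sets \<Omega>"
  using open_mean_domain by (intro sample_mean_event) simp

lemma estimator_measurable:
  "(\<lambda>\<omega>. \<phi> (sample_mean X n \<omega>)) \<in>
    restrict_space \<Omega> (good_event n) \<rightarrow>\<^sub>M borel_of (top_of_set \<Theta>)"
  unfolding borel_of_def
proof (rule measurable_measure_of)
  show "{U. openin (top_of_set \<Theta>) U} \<subseteq> Pow (topspace (top_of_set \<Theta>))"
    using openin_subset[of "top_of_set \<Theta>"] by blast
  have space: "space (restrict_space \<Omega> (good_event n)) = good_event n"
    by (simp add: space_restrict_space Int_absorb2)
  show "(\<lambda>\<omega>. \<phi> (sample_mean X n \<omega>)) \<in> space (restrict_space \<Omega> (good_event n)) \<rightarrow> topspace (top_of_set \<Theta>)"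
    using phi_range by (auto simp: space)
  fix U assume "U \<in> {U. openin (top_of_set \<Theta>) U}"
  then have "open {t \<in> M0. \<phi> t \<in> U}" using open_phi_preimage by simp
  then have "{\<omega> \<in> space \<Omega>. sample_mean X n \<omega> \<in> {t \<in> M0. \<phi> t \<in> U}} \<in> sets \<Omega>"
    by (intro sample_mean_event) simp
  moreover have "(\<lambda>\<omega>. \<phi> (sample_mean X n \<omega>)) -` U \<inter> space (restrict_space \<Omega> (good_event n)) =
      {\<omega> \<in> space \<Omega>. sample_mean X n \<omega> \<in> {t \<in> M0. \<phi> t \<in> U}}"
    by (auto simp: space)
  ultimately show "(\<lambda>\<omega>. \<phi> (sample_mean X n \<omega>)) -` U \<inter> space (restrict_space \<Omega> (good_event n))
      \<in> sets (restrict_space \<Omega> (good_event n))"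
    by (subst sets_restrict_space_iff) auto
qed

lemma emeasure_estimator_law:
  assumes A: "A \<in> sets (borel_of (top_of_set \<Theta>))"
  shows "emeasure (estimator_law lam \<Theta> \<phi> \<Omega> X n) A =
      emeasure \<Omega> {\<omega> \<in> space \<Omega>. sample_mean X n \<omega> \<in> M0 \<and> \<phi> (sample_mean X n \<omega>) \<in> A}"
    and "{\<omega> \<in> space \<Omega>. sample_mean X n \<omega> \<in> M0 \<and> \<phi> (sample_mean X n \<omega>) \<in> A} \<in> sets \<Omega>"
proof -
  let ?R = "restrict_space \<Omega> (good_event n)"
  have eq: "(\<lambda>\<omega>. \<phi> (sample_mean X n \<omega>)) -` A \<inter> space ?R =
      {\<omega> \<in> space \<Omega>. sample_mean X n \<omega> \<in> M0 \<and> \<phi> (sample_mean X n \<omega>) \<in> A}" (is "_ = ?E")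
    by (auto simp: space_restrict_space)
  have "?E \<in> sets ?R" using measurable_sets[OF estimator_measurable[of n] A] unfolding eq .
  then show "?E \<in> sets \<Omega>" by (simp add: sets_restrict_space_iff)
  have "emeasure (estimator_law lam \<Theta> \<phi> \<Omega> X n) A = emeasure ?R ?E"
    unfolding estimator_law_def emeasure_distr[OF estimator_measurable[of n] A] eq ..
  also have "\<dots> = emeasure \<Omega> ?E"
    by (rule emeasure_restrict_space) auto
  finally show "emeasure (estimator_law lam \<Theta> \<phi> \<Omega> X n) A = emeasure \<Omega> ?E" .
qed

lemma prob_space_estimator_law:
  assumes "n \<ge> 1"
  shows "prob_space (estimator_law lam \<Theta> \<phi> \<Omega> X n)"
proof (rule prob_spaceI)
  have "\<Theta> \<in> sets (borel_of (top_of_set \<Theta>))" by (intro openin_in_borel_of) simp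
  from emeasure_estimator_law(1)[OF this, of n]
  have "emeasure (estimator_law lam \<Theta> \<phi> \<Omega> X n) \<Theta> =
      emeasure \<Omega> {\<omega> \<in> space \<Omega>. sample_mean X n \<omega> \<in> M0 \<and> \<phi> (sample_mean X n \<omega>) \<in> \<Theta>}" .
  also have "{\<omega> \<in> space \<Omega>. sample_mean X n \<omega> \<in> M0 \<and> \<phi> (sample_mean X n \<omega>) \<in> \<Theta>} = good_event n"
    using phi_range by auto
  also have "emeasure \<Omega> (good_event n) = 1"
    using mean_in[OF assms] by (intro emeasure_eq_1_AE) auto
  finally show "emeasure (estimator_law lam \<Theta> \<phi> \<Omega> X n)
      (space (estimator_law lam \<Theta> \<phi> \<Omega> X n)) = 1"
    by (simp add: estimator_law_def space_borel_of)
qed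

lemma estimator_lower_bound:
  assumes A: "A \<in> sets (borel_of (top_of_set \<Theta>))"
    and \<theta>: "\<theta> \<in> top_of_set \<Theta> interior_of A"
  shows "- mle_rate \<theta> \<le>
    liminf (\<lambda>n. ereal (1 / real n) * ln_ennreal (emeasure (estimator_law lam \<Theta> \<phi> \<Omega> X n) A))"
proof -
  let ?U = "top_of_set \<Theta> interior_of A"
  let ?G = "{t \<in> M0. \<phi> t \<in> ?U}"
  have \<theta>\<Theta>: "\<theta> \<in> \<Theta>" using \<theta> interior_of_subset_topspace[of "top_of_set \<Theta>" A] by auto
  obtain t where t: "t \<in> B_set lam \<Theta> \<theta>" "mle_rate \<theta> = ereal (rate t)"
    using mle_rate_attained[OF \<theta>\<Theta>] .
  have tG: "t \<in> ?G" "t \<in> M0" using t(1) \<theta> by (auto simp: B_set_eq[OF \<theta>\<Theta>])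
  have "- mle_rate \<theta> = ereal (- rate t)" by (simp add: t)
  also have "\<dots> \<le> liminf (\<lambda>n. ereal (1 / real n) *
      ln_ennreal (emeasure \<Omega> {\<omega> \<in> space \<Omega>. sample_mean X n \<omega> \<in> ?G}))"
    by (rule sample_mean_lower_bound[OF open_phi_preimage tG]) simp
  also have "\<dots> \<le> liminf (\<lambda>n. ereal (1 / real n) *
      ln_ennreal (emeasure (estimator_law lam \<Theta> \<phi> \<Omega> X n) A))"
    unfolding emeasure_estimator_law(1)[OF A]
    using interior_of_subset[of "top_of_set \<Theta>" A] emeasure_estimator_law(2)[OF A]
    by (intro Liminf_mono always_eventually allI ereal_mult_left_mono ln_ennreal_mono emeasure_mono) auto
  finally show ?thesis .
qed

text \<open>  The preimage of the closure is closed only relative to \<open>M0\<close>. A closed set \<open>F\<close> of the whole space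
  with the same trace on \<open>M0\<close> does as well, because the bound for sample means imposes a condition
  on points of \<open>M0\<close> only.\<close>

lemma estimator_upper_bound:
  assumes A: "A \<in> sets (borel_of (top_of_set \<Theta>))"
    and a: "ereal a < (INF \<theta>\<in>top_of_set \<Theta> closure_of A. mle_rate \<theta>)"
  shows "limsup (\<lambda>n. ereal (1 / real n) *
    ln_ennreal (emeasure (estimator_law lam \<Theta> \<phi> \<Omega> X n) A)) \<le> ereal (- a)"
proof -
  let ?C = "top_of_set \<Theta> closure_of A"
  obtain F where F: "closed F" "{t \<in> M0. \<phi> t \<in> ?C} = M0 \<inter> F"
    using closed_phi_preimage[of ?C] by auto
  have "A \<subseteq> topspace (top_of_set \<Theta>)" using sets.sets_into_space[OF A] by (simp add: space_borel_of)
  then have A_sub: "A \<subseteq> ?C" by (rule closure_of_subset)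
  have "limsup (\<lambda>n. ereal (1 / real n) * ln_ennreal (emeasure (estimator_law lam \<Theta> \<phi> \<Omega> X n) A)) \<le>
      limsup (\<lambda>n. ereal (1 / real n) * ln_ennreal (emeasure \<Omega> {\<omega> \<in> space \<Omega>. sample_mean X n \<omega> \<in> F}))"
    unfolding emeasure_estimator_law(1)[OF A]
  proof (intro Limsup_mono always_eventually allI ereal_mult_left_mono ln_ennreal_mono emeasure_mono)
    fix n
    show "{\<omega> \<in> space \<Omega>. sample_mean X n \<omega> \<in> M0 \<and> \<phi> (sample_mean X n \<omega>) \<in> A} \<subseteq>
        {\<omega> \<in> space \<Omega>. sample_mean X n \<omega> \<in> F}"
      using A_sub F(2) by blast
    show "{\<omega> \<in> space \<Omega>. sample_mean X n \<omega> \<in> F} \<in> sets \<Omega>"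
      using F(1) by (intro sample_mean_event) simp
  qed simp
  also have "\<dots> \<le> ereal (- a)"
  proof (rule sample_mean_upper_bound[OF F(1)])
    fix t assume t: "t \<in> F" "t \<in> M0"
    then have "\<phi> t \<in> ?C" using F(2) by blast
    then have "(INF \<theta>\<in>?C. mle_rate \<theta>) \<le> mle_rate (\<phi> t)" by (rule INF_lower)
    also have "\<dots> \<le> ereal (rate t)" by (rule mle_rate_le[OF t(2)])
    finally have "ereal a < ereal (rate t)" using a by (rule less_le_trans[rotated])
    then show "a < rate t" by simp
  qed
  finally show ?thesis .
qed

lemma estimator_LDP:
  "satisfies_LDP (top_of_set \<Theta>) (estimator_law lam \<Theta> \<phi> \<Omega> X) mle_rate"
  unfolding satisfies_LDP_def Let_def
proof (intro conjI allI impI ballI)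
  fix n :: nat assume "1 \<le> n"
  then show "prob_space (estimator_law lam \<Theta> \<phi> \<Omega> X n)" by (rule prob_space_estimator_law)
  show "sets (estimator_law lam \<Theta> \<phi> \<Omega> X n) = sets (borel_of (top_of_set \<Theta>))"
    by (simp add: estimator_law_def)
next
  show "good_rate_function (top_of_set \<Theta>) mle_rate" by (rule good_mle_rate)
next
  fix A assume A: "A \<in> sets (borel_of (top_of_set \<Theta>))"
  let ?a = "\<lambda>n. ereal (1 / real n) * ln_ennreal (emeasure (estimator_law lam \<Theta> \<phi> \<Omega> X n) A)"
  have "- liminf ?a \<le> (INF \<theta>\<in>top_of_set \<Theta> interior_of A. mle_rate \<theta>)"
    by (rule INF_greatest) (rule ereal_uminus_le_reorder[THEN iffD1, OF estimator_lower_bound[OF A]])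
  then show "- (INF \<theta>\<in>top_of_set \<Theta> interior_of A. mle_rate \<theta>) \<le> liminf ?a"
    by (rule ereal_uminus_le_reorder[THEN iffD1])
  show "liminf ?a \<le> limsup ?a" by (rule Liminf_le_Limsup) simp
  show "limsup ?a \<le> - (INF \<theta>\<in>top_of_set \<Theta> closure_of A. mle_rate \<theta>)"
  proof (rule ccontr)
    assume "\<not> ?thesis"
    then have "- limsup ?a < (INF \<theta>\<in>top_of_set \<Theta> closure_of A. mle_rate \<theta>)"
      unfolding not_le by (rule ereal_uminus_less_reorder[THEN iffD1])
    then obtain a where a: "- limsup ?a < ereal a"
        "ereal a < (INF \<theta>\<in>top_of_set \<Theta> closure_of A. mle_rate \<theta>)"
      using ereal_dense2 by blast
    have "- ereal a < limsup ?a" using a(1) by (rule ereal_uminus_less_reorder[THEN iffD1])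
    then show False using estimator_upper_bound[OF A a(2)] by simp
  qed
qed

text \<open>  The value of the rate at \<open>mean \<theta>\<close> is \<open>D(\<theta>||\<theta>\<^sub>0)\<close>, and whether this is the minimum over the fibre is
  decided by the cone condition.\<close>

lemma mle_rate_eq_KL_iff:
  assumes \<theta>: "\<theta> \<in> \<Theta>"
  shows "mle_rate \<theta> = ereal (KL_div lam \<theta> \<theta>\<^sub>0) \<longleftrightarrow> \<theta>\<^sub>0 - \<theta> \<in> admissible_cone \<Theta> \<theta>"
    and "\<theta>\<^sub>0 - \<theta> \<notin> admissible_cone \<Theta> \<theta> \<Longrightarrow> mle_rate \<theta> < ereal (KL_div lam \<theta> \<theta>\<^sub>0)"
proof -
  have \<theta>0: "\<theta> \<in> \<Theta>0" using \<theta> Theta_subset by auto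
  have KL: "KL_div lam \<theta> \<theta>\<^sub>0 = rate (mean \<theta>)"
    using theta0 by (simp add: KL_div_eq \<theta>0 grad_conj_mean)
  show less: "mle_rate \<theta> < ereal (KL_div lam \<theta> \<theta>\<^sub>0)" if not_cone: "\<theta>\<^sub>0 - \<theta> \<notin> admissible_cone \<Theta> \<theta>"
  proof -
    obtain t where "t \<in> B_set lam \<Theta> \<theta>" "rate t < llr \<theta>\<^sub>0 \<theta> (mean \<theta>)"
      using rate_smaller_off_cone[OF \<theta> not_cone] .
    then show ?thesis
      unfolding mle_rate_def INF_less_iff KL grad_conj_mean[OF \<theta>0] by (intro bexI[of _ t]) auto
  qed
  have "mle_rate \<theta> = ereal (KL_div lam \<theta> \<theta>\<^sub>0)" if "\<theta>\<^sub>0 - \<theta> \<in> admissible_cone \<Theta> \<theta>"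
    unfolding mle_rate_def KL
    using mean_mem_B_set[OF \<theta>] rate_minimal_at_mean[OF \<theta> that]
    by (intro antisym INF_lower2[of "mean \<theta>"] INF_greatest) (auto simp: grad_conj_mean[OF \<theta>0])
  then show "mle_rate \<theta> = ereal (KL_div lam \<theta> \<theta>\<^sub>0) \<longleftrightarrow> \<theta>\<^sub>0 - \<theta> \<in> admissible_cone \<Theta> \<theta>"
    using less[THEN less_imp_neq] by blast
qed

end

theorem theorem3p3:
  fixes lam :: "'a::euclidean_space measure"
    and \<Theta> :: "'a set" and \<phi> :: "'a \<Rightarrow> 'a" and \<theta>\<^sub>0 :: 'a
    and \<Omega> :: "'b measure" and X :: "nat \<Rightarrow> 'b \<Rightarrow> 'a"
  assumes sets_lam: "sets lam = sets borel"
    and sigma_finite: "sigma_finite_measure lam"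
    and not_affine: "\<And>S. affine S \<Longrightarrow> S \<noteq> UNIV \<Longrightarrow> \<not> (AE x in lam. x \<in> S)"
    and domain_open: "open (cgf_domain lam)"
    and domain_nonempty: "cgf_domain lam \<noteq> {}"
    and Theta_closed: "closedin (top_of_set (cgf_domain lam)) \<Theta>"
    and B_partition: "partition_on (mean_domain lam) (B_set lam \<Theta> ` \<Theta>)"
    and phi_range: "\<phi> \<in> mean_domain lam \<rightarrow> \<Theta>"
    and phi_iff: "\<And>\<mu> \<theta>. \<mu> \<in> mean_domain lam \<Longrightarrow> \<theta> \<in> \<Theta> \<Longrightarrow>
      \<phi> \<mu> = \<theta> \<longleftrightarrow> \<mu> \<in> B_set lam \<Theta> \<theta>"
    and phi_cont: "continuous_on (mean_domain lam) \<phi>"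
    and theta0: "\<theta>\<^sub>0 \<in> \<Theta>"
    and Omega: "prob_space \<Omega>"
    and X_indep: "prob_space.indep_vars \<Omega> (\<lambda>_. borel) X UNIV"
    and X_law: "\<And>i. distr \<Omega> borel (X i) = exp_fam lam \<theta>\<^sub>0"
    and mean_in: "\<And>n. n \<ge> 1 \<Longrightarrow> AE \<omega> in \<Omega>. sample_mean X n \<omega> \<in> mean_domain lam"
  shows
    "(constrained_mle lam \<Theta> \<phi> \<and>
      continuous_on (mean_domain lam) \<phi> \<and>
      (\<forall>\<psi>. constrained_mle lam \<Theta> \<psi> \<longrightarrow> (\<forall>t \<in> mean_domain lam. \<psi> t = \<phi> t)) \<and>
      (\<forall>\<theta>\<in>\<Theta>. T_set lam \<phi> \<theta> = grad_conj lam ` B_set lam \<Theta> \<theta>))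
    \<and>
     (\<forall>\<theta>\<in>\<Theta>.
      (\<forall>\<theta>' \<in> T_set lam \<phi> \<theta>. KL_div lam \<theta> \<theta>\<^sub>0 \<le> KL_div lam \<theta>' \<theta>\<^sub>0) \<longleftrightarrow>
      \<theta>\<^sub>0 \<in> (\<lambda>w. \<theta> + w) ` admissible_cone \<Theta> \<theta> \<inter> \<Theta>)
    \<and>
     (\<exists>I. satisfies_LDP (top_of_set \<Theta>) (estimator_law lam \<Theta> \<phi> \<Omega> X) I \<and>
       (\<forall>\<theta>\<in>\<Theta>.
         (I \<theta> = ereal (KL_div lam \<theta> \<theta>\<^sub>0) \<longleftrightarrow>
           \<theta>\<^sub>0 \<in> (\<lambda>w. \<theta> + w) ` admissible_cone \<Theta> \<theta> \<inter> \<Theta>) \<and>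
         (\<theta>\<^sub>0 \<notin> (\<lambda>w. \<theta> + w) ` admissible_cone \<Theta> \<theta> \<inter> \<Theta> \<longrightarrow>
           I \<theta> < ereal (KL_div lam \<theta> \<theta>\<^sub>0))))"
proof -
  interpret full_exponential_family lam
    by (rule full_exponential_family.intro[OF sets_lam sigma_finite not_affine domain_open])
  have theta0_domain: "\<theta>\<^sub>0 \<in> cgf_domain lam" using theta0 closedin_subset[OF Theta_closed] by auto
  interpret prob_space \<Omega> by (rule Omega)
  interpret constrained_sampling lam \<Theta> \<phi> \<Omega> X \<theta>\<^sub>0
  proof
    show "\<Theta> \<noteq> {}" using theta0 by auto
  qed (fact Theta_closed phi_range phi_iff phi_cont theta0_domain X_indep X_law mean_in)+
  have cone_iff: "\<theta>\<^sub>0 \<in> (\<lambda>w. \<theta> + w) ` admissible_cone \<Theta> \<theta> \<inter> \<Theta> \<longleftrightarrow> \<theta>\<^sub>0 - \<theta> \<in> admissible_cone \<Theta> \<theta>" for \<theta>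
    using assms(11) by (auto simp: image_iff intro!: bexI[of _ "\<theta>\<^sub>0 - \<theta>"])
  show ?thesis
    unfolding cone_iff
  proof (intro conjI allI ballI impI exI[of _ mle_rate])
    show "\<psi> t = \<phi> t" if "constrained_mle lam \<Theta> \<psi>" "t \<in> mean_domain lam" for \<psi> t
      by (rule constrained_mle_unique[OF that])
  qed (fact constrained_mle_phi phi_cont estimator_LDP |
      rule T_set_eq KL_div_minimal_iff mle_rate_eq_KL_iff, assumption?, (rule theta0_domain)?)+
qed

end
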